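(* Consider a fluid timed Petri net that has no priority rules, is non-Zeno, and admits a positive stoichiometric invariant $e$, and suppose that all holding times are integers, so that $T:=\max_{p\in\mathcal{P}}\tau_p\in\mathbb{N}$. Let $n=|\mathcal{Q}|$, let $\rho$ be the throughput vector, and let $z$ be the trajectory associated with an initial condition. Then there exists an integer $c\ge 1$, which is the order of an element of the symmetric group $\mathrm{Sym}(nT)$, such that for all $0\le r\le c-1$, $z(tc+r)-\rho\,(tc+r)$ converges as $t\to\infty$ along integer values of $t$.
   Context: A fluid timed Petri net without priority rules consists of: two finite disjoint sets $\mathcal{P}$ (places) and $\mathcal{Q}$ (transitions); a directed bipartite graph on $\mathcal{P}\cup\mathcal{Q}$, where $x^{\mathrm{in}}$ (resp. $x^{\mathrm{out}}$) denotes the set of vertices $y$ with an arc from $y$ to $x$ (resp. from $x$ to $y$), and every transition has at least one upstream place; an initial marking $m_p\ge 0$ and a holding time $\tau_p\ge 0$ for each place $p$; a weight $\alpha_{qp}>0$ for each arc from place $p$ to transition $q$, and a weight $\alpha_{pq}>0$ for each arc from transition $q$ to place $p$. Each place $p$ is of one of two kinds. Either $p$ is ruled by (proportional) preselection: a probability vector $(\pi_{qp})_{q\in p^{\mathrm{out}}}$ is given, and every $q\in p^{\mathrm{out}}$ has $p$ as its only upstream place. Or $p$ has at most one downstream transition $q$, and then one sets $\pi_{qp}=1$. Dynamics: a trajectory is a function $z=(z_q)_{q\in\mathcal{Q}}:[-T,\infty)\to\mathbb{R}^{\mathcal{Q}}$ such that for all $t>0$ and $q\in\mathcal{Q}$,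 $$z_q(t)=\min_{p\in q^{\mathrm{in}}}\ \pi_{qp}\,\alpha_{qp}^{-1}\Big(m_p+\sum_{q'\in p^{\mathrm{in}}}\alpha_{pq'}\,z_{q'}(t-\tau_p)\Big).$$ Its initial condition is its restriction to $[-T,0]$, assumed continuous. The net is non-Zeno if its directed graph contains no directed circuit all of whose places have zero holding time. A stoichiometric invariant is a vector $e\in\mathbb{R}^{\mathcal{Q}}$ such that for all $q\in\mathcal{Q}$ and all $p\in q^{\mathrm{in}}$, $e_q=\pi_{qp}\alpha_{qp}^{-1}\sum_{q'\in p^{\mathrm{in}}}\alpha_{pq'}e_{q'}$; it is positive if all $e_q>0$. Throughput vector: $\rho=\lim_{t\to\infty}z(t)/t$, where $z$ is any trajectory; under the hypotheses here this limit exists and does not depend on the trajectory. *)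

theory Defs
  imports
    "HOL-Analysis.Analysis"
    "HOL-Algebra.Multiplicative_Group"
    "HOL-Algebra.Sym_Groups"
begin

text \<open>
  The types \<open>'p\<close> and \<open>'q\<close> are the sets of places and of transitions; \<open>(p, q) \<in> place_arcs N\<close> is an arc
  from the place \<open>p\<close> to the transition \<open>q\<close>, and \<open>(q, p) \<in> transition_arcs N\<close> an arc from \<open>q\<close> to \<open>p\<close>.
  Weights and routing carry their indices in the order of the formulas: \<open>place_weight N q p\<close> is
  \<open>\<alpha>\<^sub>q\<^sub>p\<close>, \<open>transition_weight N p q\<close> is \<open>\<alpha>\<^sub>p\<^sub>q\<close> and \<open>routing N q p\<close> is \<open>\<pi>\<^sub>q\<^sub>p\<close>. They are only
  meaningful on arcs.
\<close>

record ('p, 'q) petri_net =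
  place_arcs :: "('p \<times> 'q) set"
  transition_arcs :: "('q \<times> 'p) set"
  marking :: "'p \<Rightarrow> real"
  holding_time :: "'p \<Rightarrow> real"
  place_weight :: "'q \<Rightarrow> 'p \<Rightarrow> real"
  transition_weight :: "'p \<Rightarrow> 'q \<Rightarrow> real"
  routing :: "'q \<Rightarrow> 'p \<Rightarrow> real"

definition upstream_places :: "('p, 'q) petri_net \<Rightarrow> 'q \<Rightarrow> 'p set" where
  "upstream_places N q = {p. (p, q) \<in> place_arcs N}"

definition downstream_transitions :: "('p, 'q) petri_net \<Rightarrow> 'p \<Rightarrow> 'q set" where
  "downstream_transitions N p = {q. (p, q) \<in> place_arcs N}"

definition upstream_transitions :: "('p, 'q) petri_net \<Rightarrow> 'p \<Rightarrow> 'q set" where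
  "upstream_transitions N p = {q. (q, p) \<in> transition_arcs N}"

definition preselection_place :: "('p, 'q) petri_net \<Rightarrow> 'p \<Rightarrow> bool" where
  "preselection_place N p \<longleftrightarrow>
     (\<forall>q\<in>downstream_transitions N p. 0 \<le> routing N q p) \<and>
     (\<Sum>q\<in>downstream_transitions N p. routing N q p) = 1 \<and>
     (\<forall>q\<in>downstream_transitions N p. upstream_places N q = {p})"

definition single_output_place :: "('p, 'q) petri_net \<Rightarrow> 'p \<Rightarrow> bool" where
  "single_output_place N p \<longleftrightarrow>
     card (downstream_transitions N p) \<le> 1 \<and>
     (\<forall>q\<in>downstream_transitions N p. routing N q p = 1)"

definition fluid_net_without_priority :: "('p::finite, 'q::finite) petri_net \<Rightarrow> bool" where
  "fluid_net_without_priority N \<longleftrightarrow>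
     (\<forall>q. upstream_places N q \<noteq> {}) \<and>
     (\<forall>p. 0 \<le> marking N p) \<and>
     (\<forall>p. 0 \<le> holding_time N p) \<and>
     (\<forall>(p, q)\<in>place_arcs N. 0 < place_weight N q p) \<and>
     (\<forall>(q, p)\<in>transition_arcs N. 0 < transition_weight N p q) \<and>
     (\<forall>p. preselection_place N p \<or> single_output_place N p)"

definition max_holding_time :: "('p::finite, 'q) petri_net \<Rightarrow> real" where
  "max_holding_time N = Max (range (holding_time N))"

text \<open>
  Trajectories are functions on all of \<open>real\<close>, but their values before \<open>- max_holding_time N\<close> are
  never used. Continuity is required of the initial condition only.
\<close>

definition trajectory :: "('p::finite, 'q::finite) petri_net \<Rightarrow> (real \<Rightarrow> real ^ 'q) \<Rightarrow> bool" where
  "trajectory N z \<longleftrightarrow>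
     continuous_on {- max_holding_time N..0} z \<and>
     (\<forall>t>0. \<forall>q. z t $ q =
        (MIN p\<in>upstream_places N q. routing N q p * inverse (place_weight N q p) *
           (marking N p + (\<Sum>q'\<in>upstream_transitions N p.
              transition_weight N p q' * z (t - holding_time N p) $ q'))))"

definition net_arcs :: "('p, 'q) petri_net \<Rightarrow> ('p + 'q) rel" where
  "net_arcs N = {(Inl p, Inr q) | p q. (p, q) \<in> place_arcs N} \<union>
                {(Inr q, Inl p) | q p. (q, p) \<in> transition_arcs N}"

text \<open>
  A directed circuit is given by the cyclic list of its vertices. Repeated vertices are allowed; since
  a closed walk contains an elementary circuit through some of the same places, this does not
  affect the non-Zeno condition.
\<close>

definition directed_circuit :: "('p, 'q) petri_net \<Rightarrow> ('p + 'q) list \<Rightarrow> bool" where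
  "directed_circuit N xs \<longleftrightarrow>
     xs \<noteq> [] \<and> (\<forall>i<length xs. (xs ! i, xs ! (Suc i mod length xs)) \<in> net_arcs N)"

definition non_Zeno :: "('p, 'q) petri_net \<Rightarrow> bool" where
  "non_Zeno N \<longleftrightarrow>
     \<not> (\<exists>xs. directed_circuit N xs \<and> (\<forall>p. Inl p \<in> set xs \<longrightarrow> holding_time N p = 0))"

definition stoichiometric_invariant :: "('p::finite, 'q::finite) petri_net \<Rightarrow> real ^ 'q \<Rightarrow> bool" where
  "stoichiometric_invariant N e \<longleftrightarrow>
     (\<forall>q. \<forall>p\<in>upstream_places N q. e $ q = routing N q p * inverse (place_weight N q p) *
        (\<Sum>q'\<in>upstream_transitions N p. transition_weight N p q' * e $ q'))"

text \<open>The common limit of \<open>z t / t\<close> over all trajectories \<open>z\<close>; unspecified if there is none.\<close>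

definition throughput :: "('p::finite, 'q::finite) petri_net \<Rightarrow> real ^ 'q" where
  "throughput N = (THE \<rho>. \<forall>z. trajectory N z \<longrightarrow> ((\<lambda>t. (1 / t) *\<^sub>R z t) \<longlongrightarrow> \<rho>) at_top)"

end

theory Submission
  imports Defs
begin

text \<open>
  In the coordinates \<open>z q / e q\<close> the dynamics is that of a Markov decision process with delays: every
  transition \<open>q\<close> selects the cheapest of its upstream places \<open>p\<close>, pays a fixed cost and receives the
  average, with respect to a probability vector, of values \<open>\<tau> p\<close> time units earlier. The
  stoichiometric invariant is what makes the weights sum to one. So the dynamics is monotone,
  nonexpansive in the supremum norm, and a minimum of finitely many affine maps. The net is not Zeno,
  hence the transitions have a depth that decreases when one moves upstream across a place
  without delay; it replaces time wherever an induction or a maximum principle meets such a place.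

  The first step finds an affine trajectory \<open>v + \<rho> t\<close>, valid for large \<open>t\<close> (\<open>invariant_half_line\<close>).
  Discounting by \<open>1 + \<epsilon> \<tau>\<close> makes the stationary problem solvable; one policy is optimal for a
  sequence of discounts \<open>\<epsilon>\<close> tending to zero, and along it the solution expands as
  \<open>\<rho> / \<epsilon> + v + o(1)\<close>. By nonexpansiveness all trajectories stay within bounded distance of this
  half-line (\<open>bounded_deviation_from_drift\<close>), so \<open>\<rho>\<close> is the throughput, up to the factor \<open>e\<close>.

  At integer times, and from some time on, the difference \<open>u\<close> between a trajectory and the half-line is
  a bounded orbit of a decision process with nonnegative costs. The actions of cost zero that can be repeated
  for ever form a graph in which every edge lies on a cycle. On this critical graph \<open>u\<close> satisfies
  \<open>u \<le> P u\<close>, and the values converge along each residue class modulo \<open>c\<close> as soon as each strongly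
  connected component contains a closed walk of total delay \<open>c\<close> (\<open>converges_on_recurrent\<close>). Off the
  critical graph, the difference between the upper and the lower limits of \<open>u\<close> along the residue
  classes obeys a maximum principle whose maximum is attained on the critical graph, where it
  vanishes (\<open>bounded_orbit_periodic\<close>).

  It remains to choose \<open>c\<close>. A component with \<open>m\<close> transitions contains a closed walk of
  total delay at most \<open>m T\<close> (\<open>closed_walk_lengths\<close>). These lengths sum to at most \<open>n T\<close>, so some
  permutation of \<open>n T\<close> points has a cycle of each of these lengths, and its order is a common multiple
  of them (\<open>permutation_with_cycle_lengths\<close>).
\<close>

section \<open>Decision processes with integer delays\<close>

text \<open>
  The actions \<open>A q\<close> available at \<open>q\<close> are the upstream places of \<open>q\<close>. The depth says that no infinite
  sequence of transitions can be followed without letting time pass.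
\<close>

locale delayed_decision_process =
  fixes A :: "'q::finite \<Rightarrow> 'p set"
    and P :: "'q \<Rightarrow> 'p \<Rightarrow> 'q \<Rightarrow> real"
    and \<tau> :: "'p \<Rightarrow> nat"
    and depth :: "'q \<Rightarrow> nat"
  assumes actions_finite: "finite (A q)"
    and actions_nonempty: "A q \<noteq> {}"
    and P_nonneg: "p \<in> A q \<Longrightarrow> 0 \<le> P q p q'"
    and P_sum: "p \<in> A q \<Longrightarrow> (\<Sum>q'\<in>UNIV. P q p q') = 1"
    and depth_decreasing: "p \<in> A q \<Longrightarrow> \<tau> p = 0 \<Longrightarrow> 0 < P q p q' \<Longrightarrow> depth q' < depth q"
begin

definition avg :: "'q \<Rightarrow> 'p \<Rightarrow> ('q \<Rightarrow> real) \<Rightarrow> real" where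
  "avg q p f = (\<Sum>q'\<in>UNIV. P q p q' * f q')"

lemma avg_add: "avg q p (\<lambda>i. f i + g i) = avg q p f + avg q p g"
  by (simp add: avg_def algebra_simps sum.distrib)

lemma avg_diff: "avg q p (\<lambda>i. f i - g i) = avg q p f - avg q p g"
  by (simp add: avg_def algebra_simps sum_subtractf)

lemma avg_cmult: "avg q p (\<lambda>i. c * f i) = c * avg q p f"
  by (simp add: avg_def sum_distrib_left algebra_simps)

lemma avg_minus: "avg q p (\<lambda>i. - f i) = - avg q p f"
  by (simp add: avg_def sum_negf)

lemma avg_const: "p \<in> A q \<Longrightarrow> avg q p (\<lambda>_. c) = c"
  using P_sum[of p q] by (simp add: avg_def flip: sum_distrib_right)

lemma avg_mono:
  assumes "p \<in> A q" "\<And>q'. 0 < P q p q' \<Longrightarrow> f q' \<le> g q'"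
  shows "avg q p f \<le> avg q p g"
  unfolding avg_def
proof (rule sum_mono)
  fix q'
  show "P q p q' * f q' \<le> P q p q' * g q'"
    using assms P_nonneg[of p q q'] by (cases "P q p q' = 0") (auto intro: mult_left_mono)
qed

lemma avg_le: "p \<in> A q \<Longrightarrow> (\<And>q'. 0 < P q p q' \<Longrightarrow> f q' \<le> b) \<Longrightarrow> avg q p f \<le> b"
  using avg_mono[of p q f "\<lambda>_. b"] by (simp add: avg_const)

lemma avg_ge: "p \<in> A q \<Longrightarrow> (\<And>q'. 0 < P q p q' \<Longrightarrow> b \<le> f q') \<Longrightarrow> b \<le> avg q p f"
  using avg_mono[of p q "\<lambda>_. b" f] by (simp add: avg_const)

lemma avg_le_weighted:
  assumes p: "p \<in> A q" and b: "\<And>q'. 0 < P q p q' \<Longrightarrow> f q' \<le> b"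
  shows "avg q p f \<le> P q p j * f j + (1 - P q p j) * b"
proof -
  let ?g = "\<lambda>i. if i = j then f j else b"
  have "avg q p f \<le> avg q p ?g"
    by (rule avg_mono) (use p b in auto)
  also have "avg q p ?g = avg q p (\<lambda>i. b + (if i = j then f j - b else 0))"
    by (rule arg_cong[where f = "avg q p"]) auto
  also have "\<dots> = b + P q p j * (f j - b)"
    unfolding avg_add avg_const[OF p] by (simp add: avg_def if_distrib cong: if_cong)
  finally show ?thesis by (simp add: algebra_simps)
qed

lemma avg_max_attained:
  assumes p: "p \<in> A q" and b: "\<And>q'. 0 < P q p q' \<Longrightarrow> f q' \<le> b"
    and ge: "b \<le> avg q p f" and j: "0 < P q p j"
  shows "f j = b"
proof -
  have "P q p j * b \<le> P q p j * f j"
    using avg_le_weighted[where f = f and b = b and j = j, OF p b] ge by (simp add: algebra_simps)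
  then show ?thesis using b[OF j] j by simp
qed

lemma avg_min_attained:
  assumes "p \<in> A q" "\<And>q'. 0 < P q p q' \<Longrightarrow> b \<le> f q'" "avg q p f \<le> b" "0 < P q p j"
  shows "f j = b"
  using avg_max_attained[where p = p and q = q and f = "\<lambda>i. - f i" and b = "- b" and j = j] assms by (simp add: avg_minus)

lemma exists_successor: "p \<in> A q \<Longrightarrow> \<exists>q'. 0 < P q p q'"
  using P_sum[of p q] P_nonneg[of p q] by (metis le_less sum.neutral zero_neq_one)

text \<open>
  Zero delays make the dynamics implicit. The depth resolves this: a time step either moves
  strictly into the past or, at the same time, to a smaller depth.
\<close>

lemma delay_induct:
  assumes step: "\<And>k q. (\<And>p q'. p \<in> A q \<Longrightarrow> 0 < P q p q' \<Longrightarrow> \<tau> p \<le> k \<Longrightarrow> R (k - \<tau> p) q') \<Longrightarrow> R k q"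
  shows "R k q"
proof -
  have "\<forall>k q. (k, depth q) = x \<longrightarrow> R k q" for x
    using wf_lex_prod[OF wf_less_than wf_less_than]
  proof (induction x)
    case (less x)
    show ?case
    proof (intro allI impI)
      fix k q assume x: "(k, depth q) = x"
      show "R k q"
      proof (rule step)
        fix p q' assume p: "p \<in> A q" "0 < P q p q'" "\<tau> p \<le> k"
        have "((k - \<tau> p, depth q'), x) \<in> less_than <*lex*> less_than"
          using p depth_decreasing[of p q q'] x by auto
        then show "R (k - \<tau> p) q'" using less by blast
      qed
    qed
  qed
  then show ?thesis by blast
qed

lemma real_delay_induct:
  fixes R :: "real \<Rightarrow> 'q \<Rightarrow> bool"
  assumes delays: "\<And>p. \<tau> p \<le> T"
    and start: "\<And>(t::real) q. - real T \<le> t \<Longrightarrow> t \<le> 0 \<Longrightarrow> R t q"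
    and step: "\<And>(t::real) q. 0 < t \<Longrightarrow> (\<And>p q'. p \<in> A q \<Longrightarrow> 0 < P q p q' \<Longrightarrow> R (t - \<tau> p) q') \<Longrightarrow> R t q"
    and t: "- real T \<le> t"
  shows "R t q"
proof -
  have "\<forall>t. - real T \<le> t \<and> nat \<lceil>t + T\<rceil> = k \<longrightarrow> R t q" for k q
  proof (rule delay_induct[where R = "\<lambda>k q. \<forall>t. - real T \<le> t \<and> nat \<lceil>t + T\<rceil> = k \<longrightarrow> R t q"])
    fix k q
    assume 1: "\<And>p q'. p \<in> A q \<Longrightarrow> 0 < P q p q' \<Longrightarrow> \<tau> p \<le> k \<Longrightarrow>
      \<forall>t. - real T \<le> t \<and> nat \<lceil>t + T\<rceil> = k - \<tau> p \<longrightarrow> R t q'"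
    show "\<forall>t. - real T \<le> t \<and> nat \<lceil>t + T\<rceil> = k \<longrightarrow> R t q"
    proof (intro allI impI)
      fix t :: real assume t: "- real T \<le> t \<and> nat \<lceil>t + T\<rceil> = k"
      show "R t q"
      proof (cases "t \<le> 0")
        case False
        show "R t q"
        proof (rule step[of t q])
          fix p q' assume p: "p \<in> A q" "0 < P q p q'"
          have "\<tau> p \<le> k" using False t delays[of p] by linarith
          moreover have "nat \<lceil>t - \<tau> p + T\<rceil> = k - \<tau> p"
            using t by linarith
          moreover have "- real T \<le> t - \<tau> p" using False delays[of p] by linarith
          ultimately show "R (t - \<tau> p) q'" using 1[OF p] by blast
        qed (use False in simp)
      qed (use start t in blast)
    qed
  qed
  then show ?thesis using t by blast
qed

text \<open>
  A maximum attained at an action without delay is also attained at all of its successors, which have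
  smaller depth. Hence at a maximizer of least depth the delay is positive, and there the discount
  is strict.
\<close>

lemma maximum_at_positive_delay:
  fixes w :: "'q \<Rightarrow> real"
  assumes \<sigma>: "\<And>q. \<sigma> q \<in> A q"
    and sub: "\<And>q. \<tau> (\<sigma> q) = 0 \<Longrightarrow> w q \<le> avg q (\<sigma> q) w"
  obtains q where "\<And>q'. w q' \<le> w q" "0 < \<tau> (\<sigma> q)"
proof -
  define M where "M = {q. \<forall>q'. w q' \<le> w q}"
  have "M \<noteq> {}"
    unfolding M_def using Max_in[of "range w"] Max_ge[of "range w"] by fastforce
  then obtain q where q: "q \<in> M" and least: "\<And>q'. q' \<in> M \<Longrightarrow> depth q \<le> depth q'"
    using ex_has_least_nat[of "\<lambda>q. q \<in> M" _ depth] by blast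
  have "0 < \<tau> (\<sigma> q)"
  proof (rule ccontr)
    assume "\<not> 0 < \<tau> (\<sigma> q)"
    then have z: "\<tau> (\<sigma> q) = 0" by simp
    obtain q' where q': "0 < P q (\<sigma> q) q'" using exists_successor \<sigma> by blast
    have "w q' = w q"
      using avg_max_attained[where f = w and b = "w q" and j = q' and q = q, OF \<sigma>] sub[OF z] q q' by (auto simp: M_def)
    then have "q' \<in> M" using q by (simp add: M_def)
    then show False using least depth_decreasing[OF \<sigma> z q'] by fastforce
  qed
  then show thesis using that q by (auto simp: M_def)
qed

end

section \<open>Invariant half-lines\<close>

context delayed_decision_process
begin

lemma tendsto_avg:
  "(\<And>i. ((\<lambda>k. f k i) \<longlongrightarrow> l i) F) \<Longrightarrow> ((\<lambda>k. avg q p (f k)) \<longlongrightarrow> avg q p l) F"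
  unfolding avg_def by (intro tendsto_intros)

text \<open>
  Dividing by \<open>1 + \<epsilon> \<tau>\<close> discounts the future. The fixed point is the least supersolution above the
  subsolution \<open>- h\<close>. The barrier \<open>h\<close> is affine in the depth, which absorbs the costs of the actions
  without delay, up to the constant \<open>C / \<epsilon>\<close>, which absorbs the costs of the delayed ones; hence
  \<open>\<epsilon> x\<close> stays bounded.
\<close>

lemma discounted_fixed_point:
  fixes r :: "'q \<Rightarrow> 'p \<Rightarrow> real"
  obtains K :: real where "\<And>\<epsilon> :: real. 0 < \<epsilon> \<Longrightarrow> \<epsilon> \<le> 1 \<Longrightarrow> \<exists>x. (\<forall>q. \<bar>\<epsilon> * x q\<bar> \<le> K) \<and>
      (\<forall>q. \<forall>p\<in>A q. (1 + \<epsilon> * \<tau> p) * x q \<le> r q p + avg q p x) \<and>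
      (\<forall>q. \<exists>p\<in>A q. (1 + \<epsilon> * \<tau> p) * x q = r q p + avg q p x)"
proof -
  define b where "b = Max ((\<lambda>(q, p). \<bar>r q p\<bar>) ` (SIGMA q:UNIV. A q))"
  have b: "\<bar>r q p\<bar> \<le> b" if "p \<in> A q" for q p
    unfolding b_def by (rule Max_ge) (use that actions_finite in \<open>force+\<close>)
  have b0: "0 \<le> b"
    using b actions_nonempty by (meson abs_ge_zero all_not_in_conv order_trans)
  define d where "d = Max (range depth)"
  have d: "depth q \<le> d" for q unfolding d_def by simp
  define C where "C = b + b * d"
  have C0: "0 \<le> C" using b0 by (simp add: C_def)
  show thesis
  proof (rule that[of "b * d + C"])
    fix \<epsilon> :: real assume \<epsilon>: "0 < \<epsilon>" "\<epsilon> \<le> 1"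
    define h where "h q = b * depth q + C / \<epsilon>" for q
    have h0: "0 \<le> h q" for q using b0 C0 \<epsilon> by (simp add: h_def)
    have pos: "0 < 1 + \<epsilon> * real (\<tau> p)" for p using \<epsilon> by (simp add: add_pos_nonneg)
    have h: "\<bar>r q p\<bar> + avg q p h \<le> (1 + \<epsilon> * \<tau> p) * h q" if p: "p \<in> A q" for q p
    proof (cases "\<tau> p = 0")
      case True
      have "avg q p h \<le> b * (real (depth q) - 1) + C / \<epsilon>"
      proof (rule avg_le[OF p])
        fix q' assume "0 < P q p q'"
        then have "real (depth q') \<le> real (depth q) - 1"
          using depth_decreasing[OF p True] by fastforce
        then show "h q' \<le> b * (real (depth q) - 1) + C / \<epsilon>"
          unfolding h_def using b0 by (simp add: mult_left_mono)
      qed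
      then show ?thesis using b[OF p] True by (simp add: h_def algebra_simps)
    next
      case False
      have "avg q p h \<le> b * d + C / \<epsilon>"
        by (rule avg_le[OF p]) (use b0 d in \<open>simp add: h_def mult_left_mono\<close>)
      then have "\<bar>r q p\<bar> + avg q p h \<le> C + C / \<epsilon>" using b[OF p] by (simp add: C_def)
      also have "\<dots> = (1 + \<epsilon> * 1) * (C / \<epsilon>)" using \<epsilon> by (simp add: field_simps)
      also have "\<dots> \<le> (1 + \<epsilon> * \<tau> p) * h q"
        by (rule mult_mono) (use False \<epsilon> C0 b0 in \<open>auto simp: h_def\<close>)
      finally show ?thesis .
    qed
    define \<Phi> where "\<Phi> x q = Min ((\<lambda>p. (r q p + avg q p x) / (1 + \<epsilon> * \<tau> p)) ` A q)" for x q
    have \<Phi>_le: "\<Phi> x q \<le> c \<longleftrightarrow> (\<exists>p\<in>A q. (r q p + avg q p x) / (1 + \<epsilon> * \<tau> p) \<le> c)" for x q c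
      unfolding \<Phi>_def by (subst Min_le_iff) (use actions_finite actions_nonempty in auto)
    have \<Phi>_ge: "c \<le> \<Phi> x q \<longleftrightarrow> (\<forall>p\<in>A q. c \<le> (r q p + avg q p x) / (1 + \<epsilon> * \<tau> p))" for x q c
      unfolding \<Phi>_def by (subst Min_ge_iff) (use actions_finite actions_nonempty in auto)
    have \<Phi>_mono: "\<Phi> x q \<le> \<Phi> y q" if "\<And>q. x q \<le> y q" for x y q
    proof -
      have "\<forall>p\<in>A q. \<Phi> x q \<le> (r q p + avg q p y) / (1 + \<epsilon> * \<tau> p)"
      proof
        fix p assume p: "p \<in> A q"
        have "\<Phi> x q \<le> (r q p + avg q p x) / (1 + \<epsilon> * \<tau> p)" using \<Phi>_le p by blast
        also have "\<dots> \<le> (r q p + avg q p y) / (1 + \<epsilon> * \<tau> p)"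
          using avg_mono[OF p, of x y] that pos[of p] by (intro divide_right_mono) auto
        finally show "\<Phi> x q \<le> (r q p + avg q p y) / (1 + \<epsilon> * \<tau> p)" .
      qed
      then show ?thesis using \<Phi>_ge by blast
    qed
    define Y where "Y = {y. (\<forall>q. \<Phi> y q \<le> y q) \<and> (\<forall>q. - h q \<le> y q)}"
    have "h \<in> Y"
    proof -
      have "\<Phi> h q \<le> h q" for q
      proof -
        obtain p where p: "p \<in> A q" using actions_nonempty by blast
        have "(r q p + avg q p h) / (1 + \<epsilon> * \<tau> p) \<le> h q"
          using h[OF p] pos[of p] by (simp add: pos_divide_le_eq mult.commute)
        then show ?thesis using \<Phi>_le p by blast
      qed
      moreover have "- h q \<le> h q" for q using h0[of q] by linarith
      ultimately show ?thesis by (simp add: Y_def)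
    qed
    define x where "x q = Inf ((\<lambda>y. y q) ` Y)" for q
    have bdd: "bdd_below ((\<lambda>y. y q) ` Y)" for q
      by (rule bdd_belowI[of _ "- h q"]) (auto simp: Y_def)
    have x_le: "x q \<le> y q" if "y \<in> Y" for y q
      unfolding x_def using bdd that by (auto intro: cInf_lower)
    have x_ge: "c \<le> x q" if "\<And>y. y \<in> Y \<Longrightarrow> c \<le> y q" for c q
      unfolding x_def using that \<open>h \<in> Y\<close> by (auto intro!: cInf_greatest)
    have x_lower: "- h q \<le> x q" for q by (rule x_ge) (simp add: Y_def)
    have le: "\<Phi> x q \<le> x q" for q
    proof (rule x_ge)
      fix y assume y: "y \<in> Y"
      have "\<Phi> x q \<le> \<Phi> y q" by (rule \<Phi>_mono) (rule x_le[OF y])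
      also have "\<dots> \<le> y q" using y by (simp add: Y_def)
      finally show "\<Phi> x q \<le> y q" .
    qed
    have "\<Phi> x \<in> Y"
    proof -
      have "- h q \<le> \<Phi> x q" for q
        unfolding \<Phi>_ge
      proof
        fix p assume p: "p \<in> A q"
        have "- avg q p h \<le> avg q p x"
          unfolding avg_minus[symmetric] by (rule avg_mono[OF p]) (rule x_lower)
        then have "- ((1 + \<epsilon> * \<tau> p) * h q) \<le> r q p + avg q p x" using h[OF p] by linarith
        then show "- h q \<le> (r q p + avg q p x) / (1 + \<epsilon> * \<tau> p)"
          using pos[of p] by (simp add: pos_le_divide_eq mult.commute)
      qed
      moreover have "\<Phi> (\<Phi> x) q \<le> \<Phi> x q" for q by (rule \<Phi>_mono) (rule le)
      ultimately show ?thesis by (simp add: Y_def)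
    qed
    then have ge: "x q \<le> \<Phi> x q" for q by (rule x_le)
    have all: "(1 + \<epsilon> * \<tau> p) * x q \<le> r q p + avg q p x" if "p \<in> A q" for q p
    proof -
      have "x q \<le> (r q p + avg q p x) / (1 + \<epsilon> * \<tau> p)" using ge[of q] that unfolding \<Phi>_ge by blast
      then show ?thesis using pos[of p] by (simp only: pos_le_divide_eq mult.commute)
    qed
    have "\<exists>p\<in>A q. (1 + \<epsilon> * \<tau> p) * x q = r q p + avg q p x" for q
    proof -
      obtain p where p: "p \<in> A q" "(r q p + avg q p x) / (1 + \<epsilon> * \<tau> p) \<le> x q"
        using le[of q] unfolding \<Phi>_le by blast
      then have "r q p + avg q p x \<le> (1 + \<epsilon> * \<tau> p) * x q"
        using pos[of p] by (simp add: pos_divide_le_eq mult.commute)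
      with all[OF p(1)] show ?thesis using p(1) by (intro bexI[of _ p] antisym)
    qed
    moreover have "\<bar>\<epsilon> * x q\<bar> \<le> b * d + C" for q
    proof -
      have "\<bar>x q\<bar> \<le> h q" using x_lower[of q] x_le[OF \<open>h \<in> Y\<close>, of q] by auto
      then have "\<bar>\<epsilon> * x q\<bar> \<le> \<epsilon> * h q" using \<epsilon> by (simp add: abs_mult)
      also have "\<dots> = \<epsilon> * (b * depth q) + C" using \<epsilon> by (simp add: h_def algebra_simps)
      also have "\<epsilon> * (b * depth q) \<le> 1 * (b * d)"
        by (rule mult_mono) (use \<epsilon> b0 d in \<open>auto simp: mult_left_mono\<close>)
      finally show ?thesis by simp
    qed
    ultimately show "\<exists>x. (\<forall>q. \<bar>\<epsilon> * x q\<bar> \<le> b * d + C) \<and>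
      (\<forall>q. \<forall>p\<in>A q. (1 + \<epsilon> * \<tau> p) * x q \<le> r q p + avg q p x) \<and>
      (\<forall>q. \<exists>p\<in>A q. (1 + \<epsilon> * \<tau> p) * x q = r q p + avg q p x)"
      using all by blast
  qed
qed

lemma discounted_maximum_principle:
  fixes w c :: "'q \<Rightarrow> real" and \<epsilon> :: real
  assumes \<sigma>: "\<And>q. \<sigma> q \<in> A q" and \<epsilon>: "0 < \<epsilon>"
    and w: "\<And>q. (1 + \<epsilon> * \<tau> (\<sigma> q)) * w q = avg q (\<sigma> q) w - \<epsilon> * \<tau> (\<sigma> q) * c q"
    and c: "\<And>q. - c q \<le> \<beta>"
  shows "w q \<le> \<beta>"
proof -
  have "w q \<le> avg q (\<sigma> q) w" if "\<tau> (\<sigma> q) = 0" for q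
    using w[of q] that by simp
  then obtain m where m: "\<And>q'. w q' \<le> w m" "0 < \<tau> (\<sigma> m)"
    using maximum_at_positive_delay[OF \<sigma>, of w] by blast
  have "avg m (\<sigma> m) w \<le> w m" by (rule avg_le[OF \<sigma>]) (rule m)
  then have "\<epsilon> * \<tau> (\<sigma> m) * w m \<le> \<epsilon> * \<tau> (\<sigma> m) * (- c m)"
    using w[of m] by (simp add: algebra_simps)
  moreover have "0 < \<epsilon> * \<tau> (\<sigma> m)" using \<epsilon> m(2) by simp
  ultimately have "w m \<le> - c m" using mult_le_cancel_left_pos by blast
  then show ?thesis using m(1)[of q] c[of m] by linarith
qed

text \<open>
  Comparing powers of \<open>\<epsilon>\<close> in the discounted equation: if \<open>x = \<rho> / \<epsilon> + v + o(1)\<close> along a sequence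
  \<open>\<epsilon> \<rightarrow> 0\<close>, the terms of order \<open>1 / \<epsilon>\<close> give the (in)equations for \<open>\<rho>\<close> and, for the actions with
  equality there, the terms of order \<open>1\<close> give those for \<open>v\<close>. For the expansion, \<open>\<rho>\<close> is a limit point of
  \<open>\<epsilon> x\<close>, \<open>b\<close> solves the equation of order \<open>1\<close> for an optimal policy \<open>\<sigma>\<close>, and the remainder
  \<open>w = x - \<rho> / \<epsilon> - b\<close> is bounded by the maximum principle, so it has a limit point, too.
\<close>

theorem invariant_half_line:
  fixes r :: "'q \<Rightarrow> 'p \<Rightarrow> real"
  obtains \<rho> v :: "'q \<Rightarrow> real"
  where "\<And>q p. p \<in> A q \<Longrightarrow> \<rho> q \<le> avg q p \<rho>"
    and "\<And>q p. p \<in> A q \<Longrightarrow> avg q p \<rho> = \<rho> q \<Longrightarrow> v q + \<tau> p * \<rho> q \<le> r q p + avg q p v"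
    and "\<And>q. \<exists>p\<in>A q. avg q p \<rho> = \<rho> q \<and> v q + \<tau> p * \<rho> q = r q p + avg q p v"
proof -
  obtain K where K: "\<And>\<epsilon>::real. 0 < \<epsilon> \<Longrightarrow> \<epsilon> \<le> 1 \<Longrightarrow> \<exists>x. (\<forall>q. \<bar>\<epsilon> * x q\<bar> \<le> K) \<and>
      (\<forall>q. \<forall>p\<in>A q. (1 + \<epsilon> * \<tau> p) * x q \<le> r q p + avg q p x) \<and>
      (\<forall>q. \<exists>p\<in>A q. (1 + \<epsilon> * \<tau> p) * x q = r q p + avg q p x)"
    using discounted_fixed_point[of r] by blast
  define e where "e n = 1 / (real n + 1)" for n :: nat
  have e: "0 < e n" "e n \<le> 1" for n by (simp_all add: e_def)
  have e_lim: "e \<longlonglongrightarrow> 0" unfolding e_def using LIMSEQ_inverse_real_of_nat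
    by (simp add: inverse_eq_divide add.commute)
  have "\<forall>n. \<exists>x. (\<forall>q. \<bar>e n * x q\<bar> \<le> K) \<and>
      (\<forall>q. \<forall>p\<in>A q. (1 + e n * \<tau> p) * x q \<le> r q p + avg q p x) \<and>
      (\<forall>q. \<exists>p\<in>A q. (1 + e n * \<tau> p) * x q = r q p + avg q p x)"
    using K e by blast
  then obtain x where x_bound: "\<And>n q. \<bar>e n * x n q\<bar> \<le> K"
    and x_le: "\<And>n q p. p \<in> A q \<Longrightarrow> (1 + e n * \<tau> p) * x n q \<le> r q p + avg q p (x n)"
    and x_ex: "\<And>n q. \<exists>p\<in>A q. (1 + e n * \<tau> p) * x n q = r q p + avg q p (x n)"
    by metis
  define s where "s n q = (SOME p. p \<in> A q \<and>
    (1 + e n * \<tau> p) * x n q = r q p + avg q p (x n))" for n q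
  have "s n q \<in> A q \<and> (1 + e n * \<tau> (s n q)) * x n q = r q (s n q) + avg q (s n q) (x n)" for n q
    unfolding s_def by (rule someI_ex) (use x_ex in blast)
  then have s: "\<And>n q. s n q \<in> A q"
    and s_eq: "\<And>n q. (1 + e n * \<tau> (s n q)) * x n q = r q (s n q) + avg q (s n q) (x n)"
    by blast+
  \<comment> \<open>There are finitely many policies, so one of them is optimal along a sequence of discounts.\<close>
  have "finite (range s)"
    by (rule finite_subset[of _ "PiE UNIV A"])
      (use s actions_finite in \<open>auto intro!: finite_PiE\<close>)
  then obtain n0 where "infinite {n. s n = s n0}"
    using pigeonhole_infinite[of UNIV s] by auto
  then obtain g :: "nat \<Rightarrow> nat" where g: "strict_mono g" "\<And>k. s (g k) = s n0"
    using infinite_enumerate by (metis (mono_tags, lifting) mem_Collect_eq)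
  define \<sigma> where "\<sigma> = s n0"
  have \<sigma>: "\<sigma> q \<in> A q" for q unfolding \<sigma>_def by (rule s)
  have \<sigma>_eq: "(1 + e (g k) * \<tau> (\<sigma> q)) * x (g k) q = r q (\<sigma> q) + avg q (\<sigma> q) (x (g k))" for k q
    using s_eq[of "g k" q] by (simp add: g \<sigma>_def)
  define y :: "nat \<Rightarrow> real ^ 'q" where "y k = (\<chi> q. e (g k) * x (g k) q)" for k
  have "bounded (range y)"
  proof (rule boundedI)
    fix z assume "z \<in> range y"
    then obtain k where "z = y k" by blast
    have "norm (y k) \<le> (\<Sum>q\<in>UNIV. \<bar>y k $ q\<bar>)" by (rule norm_le_l1_cart)
    also have "\<dots> \<le> (\<Sum>q\<in>(UNIV::'q set). K)" by (rule sum_mono) (simp add: y_def x_bound)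
    finally show "norm z \<le> (\<Sum>q\<in>(UNIV::'q set). K)" by (simp only: \<open>z = y k\<close>)
  qed
  then obtain R g1 where g1: "strict_mono g1" "(y \<circ> g1) \<longlonglongrightarrow> R"
    using bounded_imp_convergent_subsequence by blast
  define \<rho> where "\<rho> q = R $ q" for q
  define e1 where "e1 k = e (g (g1 k))" for k
  define x1 where "x1 k = x (g (g1 k))" for k
  have e1: "0 < e1 k" for k using e by (simp add: e1_def)
  have "strict_mono (g \<circ> g1)" using g(1) g1(1) by (rule strict_mono_o)
  then have e1_lim: "e1 \<longlonglongrightarrow> 0"
    using LIMSEQ_subseq_LIMSEQ[OF e_lim] unfolding e1_def o_def by blast
  have x1_lim: "(\<lambda>k. e1 k * x1 k q) \<longlonglongrightarrow> \<rho> q" for q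
    using tendsto_vec_nth[OF g1(2), of q] by (simp add: y_def e1_def x1_def \<rho>_def o_def)
  have x1_eq: "(1 + e1 k * \<tau> (\<sigma> q)) * x1 k q = r q (\<sigma> q) + avg q (\<sigma> q) (x1 k)" for k q
    unfolding e1_def x1_def by (rule \<sigma>_eq)
  have x1_le: "(1 + e1 k * \<tau> p) * x1 k q \<le> r q p + avg q p (x1 k)" if "p \<in> A q" for k q p
    unfolding e1_def x1_def using that by (rule x_le)
  have \<rho>_le: "\<rho> q \<le> avg q p \<rho>" if p: "p \<in> A q" for q p
  proof -
    have "(\<lambda>k. (1 + e1 k * \<tau> p) * (e1 k * x1 k q)) \<longlonglongrightarrow> (1 + 0 * real (\<tau> p)) * \<rho> q"
      by (intro tendsto_intros e1_lim x1_lim)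
    moreover have "(\<lambda>k. e1 k * r q p + avg q p (\<lambda>i. e1 k * x1 k i)) \<longlonglongrightarrow> 0 * r q p + avg q p \<rho>"
      by (intro tendsto_intros tendsto_avg e1_lim x1_lim)
    moreover have "(1 + e1 k * \<tau> p) * (e1 k * x1 k q) \<le> e1 k * r q p + avg q p (\<lambda>i. e1 k * x1 k i)" for k
      using mult_left_mono[OF x1_le[OF p, of k] less_imp_le[OF e1[of k]]]
      by (simp add: avg_cmult algebra_simps)
    ultimately have "(1 + 0 * real (\<tau> p)) * \<rho> q \<le> 0 * r q p + avg q p \<rho>"
      using LIMSEQ_le by blast
    then show ?thesis by simp
  qed
  have \<rho>_eq: "avg q (\<sigma> q) \<rho> = \<rho> q" for q
  proof -
    have "(\<lambda>k. (1 + e1 k * \<tau> (\<sigma> q)) * (e1 k * x1 k q)) \<longlonglongrightarrow> (1 + 0 * real (\<tau> (\<sigma> q))) * \<rho> q"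
      by (intro tendsto_intros e1_lim x1_lim)
    moreover have "(\<lambda>k. e1 k * r q (\<sigma> q) + avg q (\<sigma> q) (\<lambda>i. e1 k * x1 k i))
        \<longlonglongrightarrow> 0 * r q (\<sigma> q) + avg q (\<sigma> q) \<rho>"
      by (intro tendsto_intros tendsto_avg e1_lim x1_lim)
    moreover have "(1 + e1 k * \<tau> (\<sigma> q)) * (e1 k * x1 k q) =
        e1 k * r q (\<sigma> q) + avg q (\<sigma> q) (\<lambda>i. e1 k * x1 k i)" for k
      using arg_cong[OF x1_eq[of k q], of "\<lambda>a. e1 k * a"]
      by (simp add: avg_cmult algebra_simps)
    ultimately show ?thesis using LIMSEQ_unique by fastforce
  qed
  \<comment> \<open>The residual \<open>r - \<tau> \<rho>\<close> is a limit of points of the image of \<open>I - P\<^sub>\<sigma>\<close>, which is closed.\<close>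
  define L :: "real ^ 'q \<Rightarrow> real ^ 'q" where "L a = (\<chi> q. a $ q - avg q (\<sigma> q) (\<lambda>i. a $ i))" for a
  have "linear L"
    by (rule linearI) (simp_all add: L_def vec_eq_iff avg_add avg_cmult algebra_simps)
  then have "closed (range L)"
    by (intro closed_subspace linear_subspace_image) auto
  moreover have "(\<chi> q. r q (\<sigma> q) - \<tau> (\<sigma> q) * (e1 k * x1 k q)) \<in> range L" for k
  proof -
    have "(\<chi> q. r q (\<sigma> q) - \<tau> (\<sigma> q) * (e1 k * x1 k q)) = L (\<chi> q. x1 k q)"
      using x1_eq[of k] by (simp add: L_def vec_eq_iff algebra_simps)
    then show ?thesis by simp
  qed
  moreover have "(\<lambda>k. (\<chi> q. r q (\<sigma> q) - \<tau> (\<sigma> q) * (e1 k * x1 k q)))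
      \<longlonglongrightarrow> (\<chi> q. r q (\<sigma> q) - \<tau> (\<sigma> q) * \<rho> q)"
    by (intro tendsto_vec_lambda tendsto_intros x1_lim)
  ultimately have "(\<chi> q. r q (\<sigma> q) - \<tau> (\<sigma> q) * \<rho> q) \<in> range L"
    by (rule closed_sequentially)
  then obtain a where "(\<chi> q. r q (\<sigma> q) - \<tau> (\<sigma> q) * \<rho> q) = L a" by blast
  define b where "b q = a $ q" for q
  have b: "b q - avg q (\<sigma> q) b = r q (\<sigma> q) - \<tau> (\<sigma> q) * \<rho> q" for q
    using arg_cong[OF \<open>_ = L a\<close>, of "\<lambda>z. z $ q"] by (simp add: L_def b_def[abs_def])
  define w where "w k q = x1 k q - \<rho> q / e1 k - b q" for k q
  have x1_w: "x1 k = (\<lambda>q. 1 / e1 k * \<rho> q + b q + w k q)" for k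
    by (simp add: w_def fun_eq_iff)
  have w: "(1 + e1 k * \<tau> (\<sigma> q)) * w k q = avg q (\<sigma> q) (w k) - e1 k * \<tau> (\<sigma> q) * b q" for k q
  proof -
    have "avg q (\<sigma> q) (x1 k) = 1 / e1 k * \<rho> q + avg q (\<sigma> q) b + avg q (\<sigma> q) (w k)"
      unfolding x1_w by (simp add: avg_add avg_cmult \<rho>_eq del: times_divide_eq_left)
    then have "(1 + e1 k * \<tau> (\<sigma> q)) * (1 / e1 k * \<rho> q + b q + w k q) =
        1 / e1 k * \<rho> q + b q + \<tau> (\<sigma> q) * \<rho> q + avg q (\<sigma> q) (w k)"
      using x1_eq[of k q] b[of q] x1_w[of k] by simp
    moreover have "(1 + e1 k * \<tau> (\<sigma> q)) * (1 / e1 k * \<rho> q + b q + w k q) =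
        1 / e1 k * \<rho> q + b q + (1 + e1 k * \<tau> (\<sigma> q)) * w k q
          + \<tau> (\<sigma> q) * \<rho> q * (e1 k * (1 / e1 k)) + e1 k * \<tau> (\<sigma> q) * b q"
      by (simp only: algebra_simps)
    moreover have "e1 k * (1 / e1 k) = 1" using e1[of k] by simp
    ultimately show ?thesis by simp
  qed
  define \<beta> where "\<beta> = Max (range (\<lambda>q. \<bar>b q\<bar>))"
  have \<beta>: "\<bar>b q\<bar> \<le> \<beta>" for q unfolding \<beta>_def by simp
  have w_le: "w k q \<le> \<beta>" for k q
    by (rule discounted_maximum_principle[where \<sigma> = \<sigma> and \<epsilon> = "e1 k" and c = b])
      (use \<sigma> e1 w \<beta> in \<open>auto simp: abs_le_iff\<close>)
  have w_ge: "- w k q \<le> \<beta>" for k q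
  proof (rule discounted_maximum_principle[where \<sigma> = \<sigma> and \<epsilon> = "e1 k" and c = "\<lambda>q. - b q"])
    fix q show "(1 + e1 k * \<tau> (\<sigma> q)) * - w k q =
        avg q (\<sigma> q) (\<lambda>q. - w k q) - e1 k * \<tau> (\<sigma> q) * - b q"
      using w[of k q] by (simp add: avg_minus)
  qed (use \<sigma> e1 \<beta> in \<open>auto simp: abs_le_iff\<close>)
  define u :: "nat \<Rightarrow> real ^ 'q" where "u k = (\<chi> q. w k q)" for k
  have "bounded (range u)"
  proof (rule boundedI)
    fix z assume "z \<in> range u"
    then obtain k where "z = u k" by blast
    have "norm (u k) \<le> (\<Sum>q\<in>UNIV. \<bar>u k $ q\<bar>)" by (rule norm_le_l1_cart)
    also have "\<dots> \<le> (\<Sum>q\<in>(UNIV::'q set). \<beta>)"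
      by (rule sum_mono) (use w_le w_ge in \<open>simp add: u_def abs_le_iff\<close>)
    finally show "norm z \<le> (\<Sum>q\<in>(UNIV::'q set). \<beta>)" by (simp only: \<open>z = u k\<close>)
  qed
  then obtain W g2 where g2: "strict_mono g2" "(u \<circ> g2) \<longlonglongrightarrow> W"
    using bounded_imp_convergent_subsequence by blast
  define v where "v q = b q + W $ q" for q
  define E where "E k = e1 (g2 k)" for k
  have E: "0 < E k" for k using e1 by (simp add: E_def)
  have E_lim: "E \<longlonglongrightarrow> 0"
    using LIMSEQ_subseq_LIMSEQ[OF e1_lim g2(1)] by (simp add: E_def[abs_def] o_def)
  define V where "V k q = b q + w (g2 k) q" for k q
  have V_lim: "(\<lambda>k. V k q) \<longlonglongrightarrow> v q" for q
    using tendsto_add[OF tendsto_const[of "b q"] tendsto_vec_nth[OF g2(2), of q]]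
    by (simp add: V_def v_def u_def o_def)
  have XV: "x1 (g2 k) = (\<lambda>q. 1 / E k * \<rho> q + V k q)" for k
    unfolding x1_w by (simp add: E_def V_def fun_eq_iff)
  have expand: "(1 + E k * \<tau> p) * x1 (g2 k) q - (r q p + avg q p (x1 (g2 k))) =
      V k q + \<tau> p * \<rho> q + E k * (\<tau> p * V k q) - (r q p + avg q p (V k))"
    if "avg q p \<rho> = \<rho> q" for k q p
  proof -
    have "avg q p (x1 (g2 k)) = 1 / E k * \<rho> q + avg q p (V k)"
      unfolding XV by (simp add: avg_add avg_cmult that del: times_divide_eq_left)
    moreover have "(1 + E k * \<tau> p) * x1 (g2 k) q = 1 / E k * \<rho> q + V k q
        + \<tau> p * \<rho> q * (E k * (1 / E k)) + E k * (\<tau> p * V k q)"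
      unfolding XV by (simp only: algebra_simps)
    moreover have "E k * (1 / E k) = 1" using E[of k] by simp
    ultimately show ?thesis by simp
  qed
  have residual_lim: "(\<lambda>k. V k q + \<tau> p * \<rho> q + E k * (\<tau> p * V k q) - (r q p + avg q p (V k)))
      \<longlonglongrightarrow> v q + \<tau> p * \<rho> q + 0 * (\<tau> p * v q) - (r q p + avg q p v)" for q p
    by (intro tendsto_intros tendsto_avg V_lim E_lim)
  show thesis
  proof (rule that[of \<rho> v])
    show "\<rho> q \<le> avg q p \<rho>" if "p \<in> A q" for q p using that by (rule \<rho>_le)
    show "v q + \<tau> p * \<rho> q \<le> r q p + avg q p v" if p: "p \<in> A q" "avg q p \<rho> = \<rho> q" for q p
    proof -
      have "V k q + \<tau> p * \<rho> q + E k * (\<tau> p * V k q) - (r q p + avg q p (V k)) \<le> 0" for k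
        using expand[OF p(2), of k] x1_le[OF p(1), of "g2 k"] by (simp add: E_def)
      then show ?thesis using LIMSEQ_le_const2[OF residual_lim[of q p], of 0] by auto
    qed
    show "\<exists>p\<in>A q. avg q p \<rho> = \<rho> q \<and> v q + \<tau> p * \<rho> q = r q p + avg q p v" for q
    proof -
      have "V k q + \<tau> (\<sigma> q) * \<rho> q + E k * (\<tau> (\<sigma> q) * V k q) - (r q (\<sigma> q) + avg q (\<sigma> q) (V k)) = 0" for k
        using expand[OF \<rho>_eq[of q], of k] x1_eq[of "g2 k" q] by (simp add: E_def)
      then have "v q + \<tau> (\<sigma> q) * \<rho> q + 0 * (\<tau> (\<sigma> q) * v q) - (r q (\<sigma> q) + avg q (\<sigma> q) v) = 0"
        using residual_lim[of q "\<sigma> q"] by (simp add: LIMSEQ_const_iff)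
      then show ?thesis using \<sigma>[of q] \<rho>_eq[of q] by (intro bexI[of _ "\<sigma> q"]) auto
    qed
  qed
qed

end

section \<open>Trajectories stay close to the half-line\<close>

context delayed_decision_process
begin

definition bellman :: "('q \<Rightarrow> 'p \<Rightarrow> real) \<Rightarrow> ('p \<Rightarrow> 'q \<Rightarrow> real) \<Rightarrow> 'q \<Rightarrow> real \<Rightarrow> bool" where
  "bellman r f q x \<longleftrightarrow>
     (\<forall>p\<in>A q. x \<le> r q p + avg q p (f p)) \<and> (\<exists>p\<in>A q. x = r q p + avg q p (f p))"

text \<open>
  For an action with \<open>avg q p \<rho> > \<rho> q\<close> the two sides drift apart linearly; for the others the inequality
  holds at all times.
\<close>

lemma eventually_half_line_subsolution:
  fixes \<rho> v :: "'q \<Rightarrow> real"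
  assumes "\<And>q p. p \<in> A q \<Longrightarrow> \<rho> q \<le> avg q p \<rho>"
    and "\<And>q p. p \<in> A q \<Longrightarrow> avg q p \<rho> = \<rho> q \<Longrightarrow> v q + \<tau> p * \<rho> q \<le> r q p + avg q p v"
  shows "\<forall>\<^sub>F s in at_top. \<forall>q. \<forall>p\<in>A q. v q + \<rho> q * s \<le> r q p + avg q p v + avg q p \<rho> * (s - real (\<tau> p))"
proof (intro eventually_all_finite eventually_ball_finite ballI actions_finite)
  fix q p assume p: "p \<in> A q"
  show "\<forall>\<^sub>F s in at_top. v q + \<rho> q * s \<le> r q p + avg q p v + avg q p \<rho> * (s - real (\<tau> p))"
  proof (cases "avg q p \<rho> = \<rho> q")
    case True
    have "v q + \<rho> q * s \<le> r q p + avg q p v + avg q p \<rho> * (s - \<tau> p)" for s :: real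
      using assms(2)[OF p True] True by (simp add: algebra_simps)
    then show ?thesis by simp
  next
    case False
    then have pos: "0 < avg q p \<rho> - \<rho> q" using assms(1)[OF p] by simp
    define c where "c = v q - r q p - avg q p v + avg q p \<rho> * \<tau> p"
    have "\<forall>\<^sub>F s in at_top. c / (avg q p \<rho> - \<rho> q) \<le> s" by (rule eventually_ge_at_top)
    then show ?thesis
    proof eventually_elim
      case (elim s)
      then have "c \<le> s * (avg q p \<rho> - \<rho> q)" using pos by (simp add: pos_divide_le_eq)
      then show ?case by (simp add: c_def algebra_simps)
    qed
  qed
qed

text \<open>
  The half-line, started late enough, is itself a trajectory, and the dynamics is nonexpansive in
  the supremum norm: the distance to it never exceeds its initial value.
\<close>

lemma bounded_deviation_from_drift:
  fixes X :: "real \<Rightarrow> 'q \<Rightarrow> real" and \<rho> v :: "'q \<Rightarrow> real" and T :: nat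
  assumes sup: "\<And>q p. p \<in> A q \<Longrightarrow> \<rho> q \<le> avg q p \<rho>"
    and le: "\<And>q p. p \<in> A q \<Longrightarrow> avg q p \<rho> = \<rho> q \<Longrightarrow> v q + \<tau> p * \<rho> q \<le> r q p + avg q p v"
    and ex: "\<And>q. \<exists>p\<in>A q. avg q p \<rho> = \<rho> q \<and> v q + \<tau> p * \<rho> q = r q p + avg q p v"
    and delays: "\<And>p. \<tau> p \<le> T"
    and start: "\<And>(t::real) q. - real T \<le> t \<Longrightarrow> t \<le> 0 \<Longrightarrow> \<bar>X t q\<bar> \<le> B"
    and dynamics: "\<And>(t::real) q. 0 < t \<Longrightarrow> bellman r (\<lambda>p. X (t - \<tau> p)) q (X t q)"
  shows "\<exists>K. \<forall>t\<ge>- real T. \<forall>q. \<bar>X t q - \<rho> q * t\<bar> \<le> K"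
proof -
  \<comment> \<open>From time \<open>t0\<close> on, no action undercuts the half-line.\<close>
  obtain s0 :: real where "\<And>s. s \<ge> s0 \<Longrightarrow>
      \<forall>q. \<forall>p\<in>A q. v q + \<rho> q * s \<le> r q p + avg q p v + avg q p \<rho> * (s - \<tau> p)"
    using eventually_half_line_subsolution[of \<rho> v r] sup le unfolding eventually_at_top_linorder by auto
  then obtain t0 :: real where t0: "0 \<le> t0"
    and sub: "\<And>s q p. t0 \<le> s \<Longrightarrow> p \<in> A q \<Longrightarrow>
      v q + \<rho> q * s \<le> r q p + avg q p v + avg q p \<rho> * (s - \<tau> p)"
    using that by (metis max.bounded_iff max.cobounded2)
  define h where "h s q = v q + \<rho> q * s" for s :: real and q
  have avg_h: "avg q p (h s) = avg q p v + avg q p \<rho> * s" for q p s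
    unfolding h_def by (simp add: avg_add avg_cmult[of q p s] mult.commute[of _ s])
  define D where "D = (\<Sum>q\<in>UNIV. \<bar>v q\<bar> + \<bar>\<rho> q\<bar> * (T + t0))"
  have D: "\<bar>v q\<bar> + \<bar>\<rho> q\<bar> * (T + t0) \<le> D" for q
    unfolding D_def by (rule member_le_sum) (use t0 in auto)
  have close: "\<bar>X t q - h (t + t0) q\<bar> \<le> B + D" if "- real T \<le> t" for t q
    using delays _ _ that
  proof (rule real_delay_induct[where R = "\<lambda>t q. \<bar>X t q - h (t + t0) q\<bar> \<le> B + D"])
    fix t q assume t: "- real T \<le> t" "t \<le> 0"
    have "\<bar>\<rho> q * (t + t0)\<bar> \<le> \<bar>\<rho> q\<bar> * (T + t0)"
      unfolding abs_mult by (rule mult_left_mono) (use t t0 in auto)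
    then show "\<bar>X t q - h (t + t0) q\<bar> \<le> B + D"
      using D[of q] start[OF t, of q] unfolding h_def by linarith
  next
    fix t :: real and q
    assume t: "0 < t" and IH: "\<And>p q'. p \<in> A q \<Longrightarrow> 0 < P q p q' \<Longrightarrow>
      \<bar>X (t - \<tau> p) q' - h (t - \<tau> p + t0) q'\<bar> \<le> B + D"
    have upper: "X t q \<le> h (t + t0) q + (B + D)"
    proof -
      obtain p where p: "p \<in> A q" "avg q p \<rho> = \<rho> q" "v q + \<tau> p * \<rho> q = r q p + avg q p v"
        using ex by blast
      have "X t q \<le> r q p + avg q p (X (t - \<tau> p))"
        using dynamics[OF t, of q] p(1) by (simp add: bellman_def)
      also have "avg q p (X (t - \<tau> p)) \<le> avg q p (\<lambda>i. h (t - \<tau> p + t0) i + (B + D))"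
        by (rule avg_mono[OF p(1)]) (use IH[OF p(1)] in \<open>fastforce simp: abs_le_iff\<close>)
      also have "r q p + \<dots> = h (t + t0) q + (B + D)"
      proof -
        have "avg q p (\<lambda>i. h (t - \<tau> p + t0) i + (B + D)) =
            avg q p v + \<rho> q * (t - \<tau> p + t0) + (B + D)"
          unfolding avg_add avg_const[OF p(1)] avg_h p(2) ..
        then show ?thesis using p(3) by (simp add: h_def algebra_simps)
      qed
      finally show ?thesis by simp
    qed
    obtain p where p: "p \<in> A q" "X t q = r q p + avg q p (X (t - \<tau> p))"
      using dynamics[OF t, of q] by (auto simp: bellman_def)
    have "avg q p (\<lambda>i. h (t - \<tau> p + t0) i - (B + D)) \<le> avg q p (X (t - \<tau> p))"
      by (rule avg_mono[OF p(1)]) (use IH[OF p(1)] in \<open>fastforce simp: abs_le_iff\<close>)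
    moreover have "h (t + t0) q \<le> r q p + avg q p (h (t - \<tau> p + t0))"
      using sub[of "t + t0", OF _ p(1)] t unfolding h_def[of "t + t0"] avg_h by (simp add: algebra_simps)
    ultimately have "h (t + t0) q - (B + D) \<le> X t q"
      unfolding p(2) avg_diff avg_const[OF p(1)] by linarith
    then show "\<bar>X t q - h (t + t0) q\<bar> \<le> B + D" using upper by linarith
  qed
  have "\<bar>X t q - \<rho> q * t\<bar> \<le> B + D + D" if "- real T \<le> t" for t q
  proof -
    have "\<bar>\<rho> q * t0\<bar> \<le> \<bar>\<rho> q\<bar> * (T + t0)"
      unfolding abs_mult by (rule mult_left_mono) (use t0 in auto)
    then show ?thesis using close[OF that, of q] D[of q] unfolding h_def by (simp add: algebra_simps)
  qed
  then show ?thesis by blast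
qed

end

section \<open>Recurrent sets of actions\<close>

context delayed_decision_process
begin

definition edges :: "('q \<times> 'p) set \<Rightarrow> 'q rel" where
  "edges Z = {(q, q'). \<exists>p. (q, p) \<in> Z \<and> 0 < P q p q'}"

text \<open>
  Every edge of a recurrent set of actions lies on a cycle, so its weakly connected components are
  strongly connected.
\<close>

definition recurrent :: "('q \<times> 'p) set \<Rightarrow> bool" where
  "recurrent Z \<longleftrightarrow>
     (\<forall>(q, p)\<in>Z. p \<in> A q \<and> (\<forall>q'. 0 < P q p q' \<longrightarrow> (q', q) \<in> (edges Z)\<^sup>*))"

lemma edges_mono: "Z \<subseteq> Z' \<Longrightarrow> edges Z \<subseteq> edges Z'"
  by (auto simp: edges_def)

lemma recurrent_Union:
  assumes "\<And>Z. Z \<in> \<Z> \<Longrightarrow> recurrent Z"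
  shows "recurrent (\<Union>\<Z>)"
  unfolding recurrent_def
proof (intro ballI, clarify)
  fix q p Z assume Z: "Z \<in> \<Z>" "(q, p) \<in> Z"
  have "(edges Z)\<^sup>* \<subseteq> (edges (\<Union>\<Z>))\<^sup>*" using Z by (intro rtrancl_mono edges_mono) auto
  then show "p \<in> A q \<and> (\<forall>q'. 0 < P q p q' \<longrightarrow> (q', q) \<in> (edges (\<Union>\<Z>))\<^sup>*)"
    using assms[OF Z(1)] Z(2) unfolding recurrent_def by blast
qed

lemma recurrent_action: "recurrent Z \<Longrightarrow> (q, p) \<in> Z \<Longrightarrow> p \<in> A q"
  by (auto simp: recurrent_def)

lemma recurrent_sym: "recurrent Z \<Longrightarrow> sym ((edges Z)\<^sup>*)"
proof (rule symI)
  fix a b assume Z: "recurrent Z" and "(a, b) \<in> (edges Z)\<^sup>*"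
  from this(2) show "(b, a) \<in> (edges Z)\<^sup>*"
  proof induction
    case (step b c)
    then have "(c, b) \<in> (edges Z)\<^sup>*" using Z unfolding recurrent_def edges_def by auto
    then show ?case using step by (meson rtrancl_trans)
  qed simp
qed

text \<open>
  The length of a walk is measured in time: it is the sum of the delays of its actions.
\<close>

inductive walk :: "('q \<times> 'p) set \<Rightarrow> 'q \<Rightarrow> nat \<Rightarrow> 'q \<Rightarrow> bool" for Z where
  walk_refl: "walk Z q 0 q"
| walk_step: "(q, p) \<in> Z \<Longrightarrow> 0 < P q p q' \<Longrightarrow> walk Z q' h q'' \<Longrightarrow> walk Z q (\<tau> p + h) q''"

lemma walk_trans: "walk Z a h b \<Longrightarrow> walk Z b g c \<Longrightarrow> walk Z a (h + g) c"
  by (induction rule: walk.induct) (auto intro: walk_step simp: add.assoc)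

lemma walk_rtrancl: "walk Z a h b \<Longrightarrow> (a, b) \<in> (edges Z)\<^sup>*"
  by (induction rule: walk.induct) (auto simp: edges_def intro: converse_rtrancl_into_rtrancl)

lemma rtrancl_walk: "(a, b) \<in> (edges Z)\<^sup>* \<Longrightarrow> \<exists>h. walk Z a h b"
proof (induction rule: converse_rtrancl_induct)
  case base
  then show ?case using walk_refl by blast
next
  case (step y z)
  then show ?case unfolding edges_def by (auto intro: walk_step)
qed

lemma walk_reverse: "recurrent Z \<Longrightarrow> walk Z a h b \<Longrightarrow> \<exists>g. walk Z b g a"
  by (meson recurrent_sym rtrancl_walk symD walk_rtrancl)

lemma walk_repeat: "walk Z a h a \<Longrightarrow> walk Z a (n * h) a"
  by (induction n) (auto intro: walk_refl walk_trans)

text \<open>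
  A walk of length \<open>h\<close> makes the value at its start feel the value at its end \<open>h\<close> time units
  earlier, with a weight \<open>\<pi>\<close> that depends on the walk only. The set \<open>D k\<close> collects the
  transitions that matter at time \<open>k\<close>.
\<close>

lemma walk_weight:
  assumes Z: "recurrent Z"
    and sub: "\<And>k q p. K \<le> k \<Longrightarrow> (q, p) \<in> Z \<Longrightarrow> u k q \<le> avg q p (u (k - \<tau> p))"
    and D: "\<And>k q p q'. q \<in> D k \<Longrightarrow> (q, p) \<in> Z \<Longrightarrow> 0 < P q p q' \<Longrightarrow> \<tau> p \<le> k \<Longrightarrow> q' \<in> D (k - \<tau> p)"
    and walk: "walk Z q h i"
  shows "\<exists>\<pi>>0. \<forall>k\<ge>K. \<forall>B. (\<forall>j\<ge>k. \<forall>q'\<in>D j. u j q' \<le> B) \<longrightarrow> q \<in> D (k + h) \<longrightarrow>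
           u (k + h) q \<le> \<pi> * u k i + (1 - \<pi>) * B"
  using walk
proof induction
  case (walk_refl q)
  show ?case by (rule exI[of _ 1]) auto
next
  case (walk_step q p q' h i)
  then obtain \<pi> where \<pi>: "0 < \<pi>" and bound: "\<And>k B. K \<le> k \<Longrightarrow>
      (\<forall>j\<ge>k. \<forall>q'\<in>D j. u j q' \<le> B) \<Longrightarrow> q' \<in> D (k + h) \<Longrightarrow>
      u (k + h) q' \<le> \<pi> * u k i + (1 - \<pi>) * B"
    by blast
  have p: "p \<in> A q" using Z walk_step(1) by (rule recurrent_action)
  show ?case
  proof (intro exI[of _ "P q p q' * \<pi>"] conjI allI impI)
    show "0 < P q p q' * \<pi>" using \<pi> walk_step(2) by simp
    fix k B assume k: "K \<le> k" and B: "\<forall>j\<ge>k. \<forall>q'\<in>D j. u j q' \<le> B" and q: "q \<in> D (k + (\<tau> p + h))"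
    have succ: "q'' \<in> D (k + h)" if "0 < P q p q''" for q''
      using D[OF q walk_step(1) that] by simp
    have "u (k + (\<tau> p + h)) q \<le> avg q p (u (k + h))"
      using sub[of "k + (\<tau> p + h)", OF _ walk_step(1)] k by simp
    also have "\<dots> \<le> P q p q' * u (k + h) q' + (1 - P q p q') * B"
      by (rule avg_le_weighted[OF p]) (use B succ in auto)
    also have "\<dots> \<le> P q p q' * (\<pi> * u k i + (1 - \<pi>) * B) + (1 - P q p q') * B"
      using mult_left_mono[OF bound[OF k B succ[OF walk_step(2)]] less_imp_le[OF walk_step(2)]] by simp
    finally show "u (k + (\<tau> p + h)) q \<le> P q p q' * \<pi> * u k i + (1 - P q p q' * \<pi>) * B"
      by (simp add: algebra_simps)
  qed
qed

text \<open>
  Fix the transition \<open>q0\<close> and the residue of \<open>k0\<close>. The set \<open>D k\<close> of the transitions whose value at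
  time \<open>k\<close> depends on \<open>q0\<close> at times congruent to \<open>k0\<close> is closed under the actions of \<open>Z\<close>, so
  the values on \<open>D\<close> are bounded by averages of earlier ones. Let \<open>L\<close> be their upper limit. The loop of length \<open>c\<close> turns
  congruence of times into an actual walk of every sufficiently large length; hence one value of
  \<open>q0\<close> below \<open>L\<close> would later lower the values on \<open>D\<close> during a whole window of \<open>T\<close> time units, and
  then for ever, by the same amount: this contradicts the choice of \<open>L\<close>.
\<close>

theorem converges_on_recurrent:
  fixes u :: "nat \<Rightarrow> 'q \<Rightarrow> real" and C :: real
  assumes Z: "recurrent Z"
    and sub: "\<And>k q p. K \<le> k \<Longrightarrow> (q, p) \<in> Z \<Longrightarrow> u k q \<le> avg q p (u (k - \<tau> p))"
    and bounded: "\<And>k q. \<bar>u k q\<bar> \<le> C"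
    and delays: "\<And>p. \<tau> p \<le> T"
    and c: "1 \<le> c"
    and q0: "q0 \<in> fst ` Z"
    and loop: "(q0, i) \<in> (edges Z)\<^sup>*" "walk Z i c i"
  shows "convergent (\<lambda>j. u (k0 + j * c) q0)"
proof -
  define D where "D k = {q. \<exists>h a b. walk Z q h q0 \<and> k + c * a = k0 + h + c * b}" for k
  have q0_D: "q0 \<in> D (k0 + j * c)" for j
    unfolding D_def
    by (intro CollectI exI[of _ "0::nat"] exI[of _ j] conjI walk_refl) simp
  have D_shift: "q \<in> D k" if "q \<in> D (k + j * c)" for q k j
  proof -
    from that obtain h a b where "walk Z q h q0" "k + j * c + c * a = k0 + h + c * b"
      unfolding D_def by blast
    moreover from this have "k + c * (a + j) = k0 + h + c * b" by (simp add: algebra_simps)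
    ultimately show ?thesis unfolding D_def by blast
  qed
  have D_step: "q' \<in> D (k - \<tau> p)"
    if "q \<in> D k" and p: "(q, p) \<in> Z" "0 < P q p q'" "\<tau> p \<le> k" for k q p q'
  proof -
    from that obtain h a b where h: "walk Z q h q0" "k + c * a = k0 + h + c * b"
      unfolding D_def by blast
    have step: "walk Z q (\<tau> p) q'" using walk_step[OF p(1,2) walk_refl] by simp
    then obtain g where g: "walk Z q' g q" using walk_reverse[OF Z] by blast
    have "walk Z q' (g + ((c - 1) * (\<tau> p + g) + h)) q0"
      using g step h(1) by (intro walk_trans[OF g] walk_trans[OF walk_repeat]) (auto intro: walk_trans)
    moreover have "(k - \<tau> p) + c * (a + \<tau> p + g) = k0 + (g + ((c - 1) * (\<tau> p + g) + h)) + c * b"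
    proof -
      obtain c' where "c = Suc c'" using c by (cases c) auto
      then show ?thesis using h(2) p(3) by (simp add: algebra_simps)
    qed
    ultimately show ?thesis unfolding D_def by blast
  qed
  have D_action: "\<exists>p. (q, p) \<in> Z" if "q \<in> D k" for q k
  proof -
    from that obtain h where "walk Z q h q0" unfolding D_def by blast
    then show ?thesis by cases (use q0 in auto)
  qed
  obtain h1 where h1: "walk Z q0 h1 i" using rtrancl_walk[OF loop(1)] by blast
  then obtain h2 where h2: "walk Z i h2 q0" using walk_reverse[OF Z] by blast
  have long_loop: "walk Z q0 (c * (h1 + h2) + m * c) q0" for m
  proof -
    have "walk Z q0 (h1 + (m * c + h2)) q0"
      by (intro walk_trans[OF h1] walk_trans[OF walk_repeat[OF loop(2)]] h2)
    moreover have "walk Z q0 ((c - 1) * (h1 + h2)) q0"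
      by (intro walk_repeat walk_trans[OF h1] h2)
    ultimately have "walk Z q0 ((h1 + (m * c + h2)) + (c - 1) * (h1 + h2)) q0" by (rule walk_trans)
    moreover have "(h1 + (m * c + h2)) + (c - 1) * (h1 + h2) = c * (h1 + h2) + m * c"
      using c by (cases c) (auto simp: algebra_simps)
    ultimately show ?thesis by (simp only:)
  qed
  have "\<forall>\<^sub>F n in sequentially. \<forall>q. q \<in> D (k0 + n) \<longrightarrow> walk Z q n q0"
  proof (rule eventually_all_finite)
    fix q
    have "\<forall>\<^sub>F n in sequentially. \<forall>r\<in>{..<c}. n mod c = r \<longrightarrow> q \<in> D (k0 + n) \<longrightarrow> walk Z q n q0"
    proof (intro eventually_ball_finite finite_lessThan ballI)
      fix r assume "r \<in> {..<c}"
      show "\<forall>\<^sub>F n in sequentially. n mod c = r \<longrightarrow> q \<in> D (k0 + n) \<longrightarrow> walk Z q n q0"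
      proof (cases "\<exists>h. walk Z q h q0 \<and> h mod c = r")
        case True
        then obtain h where h: "walk Z q h q0" "h mod c = r" by blast
        show ?thesis
        proof (intro eventually_sequentiallyI[of "h + c * (h1 + h2)"] impI)
          fix n assume n: "h + c * (h1 + h2) \<le> n" "n mod c = r"
          then have "c dvd n - (h + c * (h1 + h2))"
            using h(2) by (subst mod_eq_dvd_iff_nat[symmetric]) auto
          then obtain m where "n - (h + c * (h1 + h2)) = c * m" by (elim dvdE)
          then have "n = h + (c * (h1 + h2) + m * c)"
            using n(1) by (simp add: mult.commute[of m])
          then show "walk Z q n q0" using walk_trans[OF h(1) long_loop[of m]] by simp
        qed
      next
        case False
        have "q \<notin> D (k0 + n)" if "n mod c = r" for n
        proof
          assume "q \<in> D (k0 + n)"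
          then obtain h a b where "walk Z q h q0" "k0 + n + c * a = k0 + h + c * b"
            unfolding D_def by blast
          moreover from this(2) have "h mod c = n mod c"
            by (metis add_left_cancel add.assoc mod_mult_self2)
          ultimately show False using False that by blast
        qed
        then show ?thesis by auto
      qed
    qed
    then show "\<forall>\<^sub>F n in sequentially. q \<in> D (k0 + n) \<longrightarrow> walk Z q n q0"
      by eventually_elim (use c in auto)
  qed
  \<comment> \<open>the uniform bound beyond which congruence of times yields walks\<close>
  then obtain H where H: "\<And>n q. H \<le> n \<Longrightarrow> q \<in> D (k0 + n) \<Longrightarrow> walk Z q n q0"
    unfolding eventually_sequentially by blast
  \<comment> \<open>\<open>F\<close> lists the finitely many walks whose lengths fill the window, and \<open>\<pi>\<close> is the least of their weights.\<close>
  define W where "W = (\<lambda>(n, q) \<pi>. 0 < \<pi> \<and> (\<forall>k\<ge>K. \<forall>B. (\<forall>j\<ge>k. \<forall>q'\<in>D j. u j q' \<le> B) \<longrightarrow>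
      q \<in> D (k + n) \<longrightarrow> u (k + n) q \<le> \<pi> * u k q0 + (1 - \<pi>) * B))"
  define F where "F = {(n, q). n \<in> {H..H + T} \<and> walk Z q n q0}"
  have "finite F" by (rule finite_subset[of _ "{H..H + T} \<times> UNIV"]) (auto simp: F_def)
  have "\<forall>f\<in>F. \<exists>\<pi>. W f \<pi>"
    using walk_weight[OF Z, of K u D] sub D_step by (fastforce simp: F_def W_def)
  then obtain w where w: "\<And>f. f \<in> F \<Longrightarrow> W f (w f)" by metis
  define \<pi> where "\<pi> = Min (insert 1 (w ` F))"
  have \<pi>: "0 < \<pi>" "\<And>f. f \<in> F \<Longrightarrow> \<pi> \<le> w f"
    unfolding \<pi>_def using \<open>finite F\<close> w by (auto simp: W_def)
  define S where "S = {B. \<exists>k1. \<forall>k\<ge>k1. \<forall>q\<in>D k. u k q \<le> B}"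
  define L where "L = Inf S"
  have "C \<in> S" unfolding S_def using bounded by (auto simp: abs_le_iff)
  have bdd: "bdd_below S"
  proof (rule bdd_belowI[of _ "- C"])
    fix B assume "B \<in> S"
    then obtain k1 where k1: "\<And>k q. k1 \<le> k \<Longrightarrow> q \<in> D k \<Longrightarrow> u k q \<le> B" unfolding S_def by blast
    have "k1 \<le> k0 + k1 * c" using c by (simp add: trans_le_add2)
    then have "u (k0 + k1 * c) q0 \<le> B" using k1 q0_D by blast
    then show "- C \<le> B" using bounded[of "k0 + k1 * c" q0] by linarith
  qed
  have upper: "\<exists>k1. \<forall>k\<ge>k1. \<forall>q\<in>D k. u k q \<le> L + \<epsilon>" if "0 < \<epsilon>" for \<epsilon>
  proof -
    have "S \<noteq> {}" "Inf S < L + \<epsilon>" using \<open>C \<in> S\<close> that by (auto simp: L_def)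
    then obtain B where "B \<in> S" "B < L + \<epsilon>" using cInf_lessD by blast
    then show ?thesis unfolding S_def by force
  qed
  have lower: "L \<le> B" if "\<forall>k\<ge>k1. \<forall>q\<in>D k. u k q \<le> B" for B k1
    unfolding L_def by (rule cInf_lower[OF _ bdd]) (use that in \<open>auto simp: S_def\<close>)
  have "(\<lambda>j. u (k0 + j * c) q0) \<longlonglongrightarrow> L"
  proof (rule LIMSEQ_I)
    fix \<epsilon> :: real assume \<epsilon>: "0 < \<epsilon>"
    \<comment> \<open>A value of at most \<open>L - \<epsilon>\<close> with weight \<open>\<pi>\<close> lowers the bound \<open>B\<close> by at least \<open>\<pi> * \<epsilon>\<close>, twice its excess over \<open>L\<close>.\<close>
    define B where "B = L + \<pi> * \<epsilon> / 2"
    have "0 < \<pi> * \<epsilon> / 2" using \<pi>(1) \<epsilon> by simp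
    then obtain k1 where k1: "\<And>k q. k1 \<le> k \<Longrightarrow> q \<in> D k \<Longrightarrow> u k q \<le> B"
      unfolding B_def using upper by meson
    have far: "k \<le> k0 + j * c" if "k \<le> j" for k j
      using that c by (metis le_add2 le_trans mult.right_neutral mult_le_mono2 trans_le_add2)
    have not_low: "L - \<epsilon> < u (k0 + j * c) q0" if j: "max k1 K \<le> j" for j
    proof (rule ccontr)
      define k where "k = k0 + j * c"
      have k: "k1 \<le> k" "K \<le> k" using far[of k1 j] far[of K j] j by (auto simp: k_def)
      assume "\<not> L - \<epsilon> < u (k0 + j * c) q0"
      then have low: "u k q0 \<le> L - \<epsilon>" by (simp add: k_def)
      define B' where "B' = L - \<pi> * \<epsilon> / 2"
      have window: "u (k + n) q \<le> B'" if n: "n \<in> {H..H + T}" "q \<in> D (k + n)" for n q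
      proof -
        have "q \<in> D (k0 + n)" using D_shift[of q "k0 + n" j] n(2) by (simp add: k_def algebra_simps)
        then have f: "(n, q) \<in> F" using H n(1) by (auto simp: F_def)
        have "u (k + n) q \<le> w (n, q) * u k q0 + (1 - w (n, q)) * B"
          using w[OF f] k k1 n(2) by (auto simp: W_def)
        also have "\<dots> = B - w (n, q) * (B - u k q0)" by (simp add: algebra_simps)
        also have "\<dots> \<le> B - \<pi> * (B - u k q0)"
          using \<pi>(2)[OF f] k1[OF k(1), of q0] q0_D[of j] by (simp add: k_def mult_right_mono)
        also have "\<dots> \<le> B - \<pi> * \<epsilon>"
          using \<pi>(1) low \<open>0 < \<pi> * \<epsilon> / 2\<close> unfolding B_def by (intro diff_left_mono mult_left_mono) auto
        finally show ?thesis by (simp add: B_def B'_def mult.commute[of \<epsilon>])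
      qed
      have "k + H \<le> k' \<longrightarrow> q \<in> D k' \<longrightarrow> u k' q \<le> B'" for k' q
      proof (rule delay_induct[where R = "\<lambda>k' q. k + H \<le> k' \<longrightarrow> q \<in> D k' \<longrightarrow> u k' q \<le> B'"], intro impI)
        fix k' q
        assume IH: "\<And>p q'. p \<in> A q \<Longrightarrow> 0 < P q p q' \<Longrightarrow> \<tau> p \<le> k' \<Longrightarrow>
            k + H \<le> k' - \<tau> p \<longrightarrow> q' \<in> D (k' - \<tau> p) \<longrightarrow> u (k' - \<tau> p) q' \<le> B'"
          and k': "k + H \<le> k'" and q: "q \<in> D k'"
        show "u k' q \<le> B'"
        proof (cases "k' \<le> k + H + T")
          case True
          then have "k' - k \<in> {H..H + T}" "k + (k' - k) = k'" using k' by auto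
          then show ?thesis using window[of "k' - k" q] q by (simp only:)
        next
          case False
          obtain p where p: "(q, p) \<in> Z" using D_action[OF q] by blast
          have pA: "p \<in> A q" using Z p by (rule recurrent_action)
          have "u k' q \<le> avg q p (u (k' - \<tau> p))" using sub[OF _ p] k' k by simp
          also have "\<dots> \<le> B'"
          proof (rule avg_le[OF pA])
            fix q' assume q': "0 < P q p q'"
            show "u (k' - \<tau> p) q' \<le> B'"
              using IH[OF pA q'] D_step[OF q p q'] False delays[of p] by auto
          qed
          finally show ?thesis .
        qed
      qed
      then have "L \<le> B'" using lower[of "k + H" B'] by blast
      then show False using \<open>0 < \<pi> * \<epsilon> / 2\<close> by (simp add: B'_def)
    qed
    obtain k2 where k2: "\<And>k q. k2 \<le> k \<Longrightarrow> q \<in> D k \<Longrightarrow> u k q \<le> L + \<epsilon> / 2"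
      using upper[of "\<epsilon> / 2"] \<epsilon> by auto
    show "\<exists>no. \<forall>j\<ge>no. norm (u (k0 + j * c) q0 - L) < \<epsilon>"
    proof (intro exI[of _ "max k2 (max k1 K)"] allI impI)
      fix j assume j: "max k2 (max k1 K) \<le> j"
      have "u (k0 + j * c) q0 \<le> L + \<epsilon> / 2" using k2 far[of k2 j] j q0_D by auto
      then show "norm (u (k0 + j * c) q0 - L) < \<epsilon>" using not_low[of j] j \<epsilon> by auto
    qed
  qed
  then show ?thesis by (rule convergentI)
qed

end

section \<open>Periodicity of bounded orbits\<close>

text \<open>
  The number \<open>L r\<close> is the upper limit along the residue class of \<open>r\<close>. The eventual and the frequent bound
  are the form in which such limits pass through averages of delayed values.
\<close>

lemma periodic_limsup:
  fixes x :: "nat \<Rightarrow> real" and c :: nat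
  assumes c: "1 \<le> c" and bounded: "\<And>k. \<bar>x k\<bar> \<le> C"
  shows "\<exists>L. (\<forall>\<epsilon>>0. \<forall>\<^sub>F k in sequentially. x k \<le> L (k mod c) + \<epsilon>) \<and>
             (\<forall>\<epsilon>>0. \<forall>r<c. \<forall>N. \<exists>k\<ge>N. k mod c = r \<and> L r - \<epsilon> \<le> x k)"
proof -
  define S where "S r = {B. \<exists>N. \<forall>k\<ge>N. k mod c = r \<longrightarrow> x k \<le> B}" for r
  have S: "C \<in> S r" for r using bounded by (auto simp: S_def abs_le_iff)
  have bdd: "bdd_below (S r)" if "r < c" for r
  proof (rule bdd_belowI[of _ "- C"])
    fix B assume "B \<in> S r"
    then obtain N where N: "\<forall>k\<ge>N. k mod c = r \<longrightarrow> x k \<le> B" by (auto simp: S_def)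
    have "N \<le> r + N * c" "(r + N * c) mod c = r" using c that by (auto simp: trans_le_add2)
    then have "x (r + N * c) \<le> B" using N by blast
    then show "- C \<le> B" using bounded[of "r + N * c"] by linarith
  qed
  have up: "\<forall>\<^sub>F k in sequentially. x k \<le> Inf (S (k mod c)) + \<epsilon>" if \<epsilon>: "0 < \<epsilon>" for \<epsilon>
  proof -
    have "\<forall>\<^sub>F k in sequentially. \<forall>r\<in>{..<c}. k mod c = r \<longrightarrow> x k \<le> Inf (S r) + \<epsilon>"
    proof (intro eventually_ball_finite finite_lessThan ballI)
      fix r assume "r \<in> {..<c}"
      have "S r \<noteq> {}" "Inf (S r) < Inf (S r) + \<epsilon>" using S[of r] \<epsilon> by auto
      then obtain B where "B \<in> S r" "B < Inf (S r) + \<epsilon>" using cInf_lessD by blast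
      then show "\<forall>\<^sub>F k in sequentially. k mod c = r \<longrightarrow> x k \<le> Inf (S r) + \<epsilon>"
        unfolding S_def eventually_sequentially by force
    qed
    then show ?thesis by eventually_elim (use c in auto)
  qed
  have fr: "\<exists>k\<ge>N. k mod c = r \<and> Inf (S r) - \<epsilon> \<le> x k" if "0 < \<epsilon>" "r < c" for \<epsilon> r N
  proof (rule ccontr)
    assume "\<not> ?thesis"
    then have "Inf (S r) - \<epsilon> \<in> S r" unfolding S_def by force
    then have "Inf (S r) \<le> Inf (S r) - \<epsilon>" by (rule cInf_lower) (rule bdd[OF that(2)])
    then show False using that by simp
  qed
  show ?thesis
    by (intro exI[of _ "\<lambda>r. Inf (S r)"] conjI allI impI up fr)
qed

lemma diff_mod_eq:
  fixes k t c :: nat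
  assumes "1 \<le> c" "t \<le> k"
  shows "(k - t) mod c = (k mod c + (c - 1) * t) mod c"
proof -
  have "(k mod c + (c - 1) * t) mod c = (k + (c - 1) * t) mod c" by (simp add: mod_add_left_eq)
  also have "k + (c - 1) * t = (k - t) + c * t" using assms by (cases c) auto
  finally show ?thesis by simp
qed

text \<open>
  A point whose set of reachable points is smallest can be reached back from each of them.
\<close>

lemma exists_recurrent_point:
  assumes "finite S" "S \<noteq> {}" and closed: "\<And>x y. x \<in> S \<Longrightarrow> (x, y) \<in> G \<Longrightarrow> y \<in> S"
  shows "\<exists>x\<in>S. \<forall>y. (x, y) \<in> G\<^sup>* \<longrightarrow> y \<in> S \<and> (y, x) \<in> G\<^sup>*"
proof -
  have reach: "y \<in> S" if "(x, y) \<in> G\<^sup>*" "x \<in> S" for x y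
    using that by induction (use closed in auto)
  obtain x where x: "x \<in> S" and least: "\<And>y. y \<in> S \<Longrightarrow> card (G\<^sup>* `` {x}) \<le> card (G\<^sup>* `` {y})"
    using ex_has_least_nat[of "\<lambda>x. x \<in> S" _ "\<lambda>x. card (G\<^sup>* `` {x})"] assms(2) by blast
  have "(y, x) \<in> G\<^sup>*" if y: "(x, y) \<in> G\<^sup>*" for y
  proof -
    have "G\<^sup>* `` {y} \<subseteq> G\<^sup>* `` {x}" using y by auto
    moreover have "finite (G\<^sup>* `` {x})"
      by (rule finite_subset[OF _ assms(1)]) (use reach x in auto)
    ultimately have "G\<^sup>* `` {y} = G\<^sup>* `` {x}"
      using least[OF reach[OF y x]] by (intro card_seteq) auto
    then show ?thesis by blast
  qed
  then show ?thesis using x reach by blast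
qed

context delayed_decision_process
begin

text \<open>
  Recurrent sets are closed under unions, so this is the largest recurrent set of actions of cost zero.
\<close>

definition critical :: "('q \<Rightarrow> 'p \<Rightarrow> real) \<Rightarrow> ('q \<times> 'p) set" where
  "critical s = \<Union>{Z. recurrent Z \<and> (\<forall>(q, p)\<in>Z. s q p = 0)}"

lemma recurrent_critical: "recurrent (critical s)"
  unfolding critical_def by (rule recurrent_Union) simp

text \<open>
  Let \<open>U\<close> and \<open>L\<close> be the upper and lower limits along the residue classes modulo \<open>c\<close>. In space-time
  \<open>U \<le> s + P U\<close> holds for all actions and \<open>L \<ge> s + P L\<close> for some action \<open>a\<close>. Hence
  \<open>U - L \<le> P U - P L\<close> for \<open>a\<close>, and the set where the gap \<open>U - L\<close> is maximal is closed under \<open>a\<close>. Where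
  \<open>L\<close> is minimal on this set, \<open>s \<ge> 0\<close> forces \<open>s = 0\<close>, and \<open>L\<close> is minimal at the successors as well.
  So \<open>a\<close> eventually runs in a recurrent set of actions of cost zero. There the orbit converges,
  so the maximal gap is zero.
\<close>

theorem bounded_orbit_periodic:
  fixes u :: "nat \<Rightarrow> 'q \<Rightarrow> real" and s :: "'q \<Rightarrow> 'p \<Rightarrow> real" and C :: real
  assumes s: "\<And>q p. p \<in> A q \<Longrightarrow> 0 \<le> s q p"
    and dynamics: "\<And>k q. K \<le> k \<Longrightarrow> bellman s (\<lambda>p. u (k - \<tau> p)) q (u k q)"
    and bounded: "\<And>k q. \<bar>u k q\<bar> \<le> C"
    and delays: "\<And>p. \<tau> p \<le> T"
    and c: "1 \<le> c"
    and loops: "\<And>q. q \<in> fst ` critical s \<Longrightarrow>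
      \<exists>i. (q, i) \<in> (edges (critical s))\<^sup>* \<and> walk (critical s) i c i"
  shows "convergent (\<lambda>j. u (k0 + j * c) q0)"
proof -
  define prev where "prev r p = (r + (c - 1) * \<tau> p) mod c" for r p
  have prev: "(k - \<tau> p) mod c = prev (k mod c) p" if "\<tau> p \<le> k" for k p
    unfolding prev_def using c that by (rule diff_mod_eq)
  have prev_less: "prev r p < c" for r p using c by (simp add: prev_def)
  have "\<forall>q. \<exists>U. (\<forall>\<epsilon>>0. \<forall>\<^sub>F k in sequentially. u k q \<le> U (k mod c) + \<epsilon>) \<and>
             (\<forall>\<epsilon>>0. \<forall>r<c. \<forall>N. \<exists>k\<ge>N. k mod c = r \<and> U r - \<epsilon> \<le> u k q)"
    by (intro allI periodic_limsup[OF c, where C = C]) (simp add: bounded)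
  from choice[OF this] obtain U where
    U: "\<forall>q. (\<forall>\<epsilon>>0. \<forall>\<^sub>F k in sequentially. u k q \<le> U q (k mod c) + \<epsilon>) \<and>
             (\<forall>\<epsilon>>0. \<forall>r<c. \<forall>N. \<exists>k\<ge>N. k mod c = r \<and> U q r - \<epsilon> \<le> u k q)" ..
  have U_ev: "\<forall>\<^sub>F k in sequentially. u k q \<le> U q (k mod c) + \<epsilon>" if "0 < \<epsilon>" for q \<epsilon>
    using U[rule_format, THEN conjunct1, rule_format, OF that] .
  have U_fr: "\<exists>k\<ge>N. k mod c = r \<and> U q r - \<epsilon> \<le> u k q" if "0 < \<epsilon>" "r < c" for q \<epsilon> r N
    using U[rule_format, THEN conjunct2, rule_format, OF that] .
  have "\<forall>q. \<exists>L. (\<forall>\<epsilon>>0. \<forall>\<^sub>F k in sequentially. - u k q \<le> L (k mod c) + \<epsilon>) \<and>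
             (\<forall>\<epsilon>>0. \<forall>r<c. \<forall>N. \<exists>k\<ge>N. k mod c = r \<and> L r - \<epsilon> \<le> - u k q)"
    by (intro allI periodic_limsup[OF c, where C = C]) (simp add: bounded)
  from choice[OF this] obtain L' where
    L': "\<forall>q. (\<forall>\<epsilon>>0. \<forall>\<^sub>F k in sequentially. - u k q \<le> L' q (k mod c) + \<epsilon>) \<and>
             (\<forall>\<epsilon>>0. \<forall>r<c. \<forall>N. \<exists>k\<ge>N. k mod c = r \<and> L' q r - \<epsilon> \<le> - u k q)" ..
  define L where "L q r = - L' q r" for q r
  have L_ev: "\<forall>\<^sub>F k in sequentially. L q (k mod c) - \<epsilon> \<le> u k q" if "0 < \<epsilon>" for q \<epsilon>
    using L'[rule_format, THEN conjunct1, rule_format, OF that, of q] by eventually_elim (simp add: L_def)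
  have L_fr: "\<exists>k\<ge>N. k mod c = r \<and> u k q \<le> L q r + \<epsilon>" if "0 < \<epsilon>" "r < c" for q \<epsilon> r N
    using L'[rule_format, THEN conjunct2, rule_format, OF that, of N q] by (force simp: L_def)
  have late: "\<forall>\<^sub>F k in sequentially. \<forall>j\<ge>k - T. \<forall>q. u j q \<le> U q (j mod c) + \<epsilon> \<and> L q (j mod c) - \<epsilon> \<le> u j q"
    if "0 < \<epsilon>" for \<epsilon>
  proof -
    have "\<forall>\<^sub>F k in sequentially. \<forall>q. u k q \<le> U q (k mod c) + \<epsilon> \<and> L q (k mod c) - \<epsilon> \<le> u k q"
      using U_ev[OF that] L_ev[OF that] by (intro eventually_all_finite eventually_conj)
    then obtain N where "\<forall>k\<ge>N. \<forall>q. u k q \<le> U q (k mod c) + \<epsilon> \<and> L q (k mod c) - \<epsilon> \<le> u k q"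
      unfolding eventually_sequentially by blast
    then show ?thesis by (intro eventually_sequentiallyI[of "N + T"]) auto
  qed
  have U_step: "U q r \<le> s q p + avg q p (\<lambda>i. U i (prev r p))" if p: "p \<in> A q" and r: "r < c" for q r p
  proof (rule field_le_epsilon)
    fix \<epsilon> :: real assume "0 < \<epsilon>"
    then have \<epsilon>: "0 < \<epsilon> / 2" by simp
    obtain N where N: "\<And>k j q. N \<le> k \<Longrightarrow> k - T \<le> j \<Longrightarrow> u j q \<le> U q (j mod c) + \<epsilon> / 2"
      using late[OF \<epsilon>] unfolding eventually_sequentially by blast
    obtain k where k: "max N (max K T) \<le> k" "k mod c = r" "U q r - \<epsilon> / 2 \<le> u k q"
      using U_fr[OF \<epsilon> r] by blast
    have "u k q \<le> s q p + avg q p (u (k - \<tau> p))"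
      using dynamics[of k q] k p by (auto simp: bellman_def)
    also have "avg q p (u (k - \<tau> p)) \<le> avg q p (\<lambda>i. U i (prev r p) + \<epsilon> / 2)"
    proof (rule avg_mono[OF p])
      fix i
      have "\<tau> p \<le> k" "k - T \<le> k - \<tau> p" using k(1) delays[of p] by auto
      then show "u (k - \<tau> p) i \<le> U i (prev r p) + \<epsilon> / 2"
        using N[of k "k - \<tau> p" i] k prev[of p k] by simp
    qed
    finally show "U q r \<le> s q p + avg q p (\<lambda>i. U i (prev r p)) + \<epsilon>"
      using k(3) by (simp add: avg_add avg_const[OF p])
  qed
  have L_step: "\<exists>p\<in>A q. s q p + avg q p (\<lambda>i. L i (prev r p)) \<le> L q r" if r: "r < c" for q r
  proof -
    let ?f = "\<lambda>p. s q p + avg q p (\<lambda>i. L i (prev r p))"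
    have "Min (?f ` A q) \<le> L q r"
    proof (rule field_le_epsilon)
      fix \<epsilon> :: real assume "0 < \<epsilon>"
      then have \<epsilon>: "0 < \<epsilon> / 2" by simp
      obtain N where N: "\<And>k j q. N \<le> k \<Longrightarrow> k - T \<le> j \<Longrightarrow> L q (j mod c) - \<epsilon> / 2 \<le> u j q"
        using late[OF \<epsilon>] unfolding eventually_sequentially by blast
      obtain k where k: "max N (max K T) \<le> k" "k mod c = r" "u k q \<le> L q r + \<epsilon> / 2"
        using L_fr[OF \<epsilon> r] by blast
      obtain p where p: "p \<in> A q" "u k q = s q p + avg q p (u (k - \<tau> p))"
        using dynamics[of k q] k by (auto simp: bellman_def)
      have "avg q p (\<lambda>i. L i (prev r p) - \<epsilon> / 2) \<le> avg q p (u (k - \<tau> p))"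
      proof (rule avg_mono[OF p(1)])
        fix i
        have "\<tau> p \<le> k" "k - T \<le> k - \<tau> p" using k(1) delays[of p] by auto
        then show "L i (prev r p) - \<epsilon> / 2 \<le> u (k - \<tau> p) i"
          using N[of k "k - \<tau> p" i] k prev[of p k] by simp
      qed
      then have "?f p \<le> L q r + \<epsilon>" using k(3) p(2) by (simp add: avg_diff avg_const[OF p(1)])
      moreover have "Min (?f ` A q) \<le> ?f p" using p(1) actions_finite by simp
      ultimately show "Min (?f ` A q) \<le> L q r + \<epsilon>" by linarith
    qed
    moreover have "Min (?f ` A q) \<in> ?f ` A q"
      by (rule Min_in) (use actions_finite actions_nonempty in auto)
    then obtain p where "p \<in> A q" "Min (?f ` A q) = ?f p" by (rule imageE)
    ultimately show ?thesis by (intro bexI[of _ p]) simp_all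
  qed
  \<comment> \<open>an action that is optimal for \<open>L\<close>\<close>
  define a where "a q r = (SOME p. p \<in> A q \<and> s q p + avg q p (\<lambda>i. L i (prev r p)) \<le> L q r)" for q r
  have "a q r \<in> A q \<and> s q (a q r) + avg q (a q r) (\<lambda>i. L i (prev r (a q r))) \<le> L q r" if "r < c" for q r
    unfolding a_def by (rule someI_ex) (use L_step[OF that] in blast)
  then have a: "\<And>q r. r < c \<Longrightarrow> a q r \<in> A q"
    and a_le: "\<And>q r. r < c \<Longrightarrow> s q (a q r) + avg q (a q r) (\<lambda>i. L i (prev r (a q r))) \<le> L q r"
    by blast+
  define gap where "gap = (\<lambda>(q, r). U q r - L q r)"
  define \<Delta> where "\<Delta> = Max (gap ` (UNIV \<times> {..<c}))"
  have gap_le: "gap (q, r) \<le> \<Delta>" if "r < c" for q r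
    unfolding \<Delta>_def by (rule Max_ge) (use that in auto)
  have gap_step: "gap (q, r) \<le> avg q (a q r) (\<lambda>i. gap (i, prev r (a q r)))" if r: "r < c" for q r
    using U_step[OF a[OF r] r, of q] a_le[OF r, of q] by (simp add: gap_def avg_diff)
  define G where "G = {((q, r), (q', r')). 0 < P q (a q r) q' \<and> r' = prev r (a q r)}"
  define S where "S = {(q, r). r < c \<and> gap (q, r) = \<Delta>}"
  have "finite S" by (rule finite_subset[of _ "UNIV \<times> {..<c}"]) (auto simp: S_def)
  have "S \<noteq> {}"
  proof -
    have "\<Delta> \<in> gap ` (UNIV \<times> {..<c})"
      unfolding \<Delta>_def by (rule Max_in) (use c in \<open>auto simp: lessThan_empty_iff\<close>)
    then show ?thesis by (auto simp: S_def)
  qed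
  have S_closed: "(q', prev r (a q r)) \<in> S" if "(q, r) \<in> S" "0 < P q (a q r) q'" for q r q'
  proof -
    have r: "r < c" and "gap (q, r) = \<Delta>" using that(1) by (auto simp: S_def)
    then have "gap (q', prev r (a q r)) = \<Delta>"
      using gap_step[OF r, of q] gap_le[OF prev_less] that(2)
      by (intro avg_max_attained[where f = "\<lambda>i. gap (i, prev r (a q r))", OF a[OF r]]) auto
    then show ?thesis by (simp add: S_def prev_less)
  qed
  define m where "m = Min ((\<lambda>(q, r). L q r) ` S)"
  have m_le: "m \<le> L q r" if "(q, r) \<in> S" for q r
  proof -
    have "(\<lambda>(q, r). L q r) (q, r) \<in> (\<lambda>(q, r). L q r) ` S" using that by (rule imageI)
    then show ?thesis unfolding m_def using \<open>finite S\<close> by (intro Min_le) auto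
  qed
  define S' where "S' = {(q, r) \<in> S. L q r = m}"
  have "S' \<noteq> {}"
  proof -
    have "m \<in> (\<lambda>(q, r). L q r) ` S"
      unfolding m_def by (rule Min_in) (use \<open>finite S\<close> \<open>S \<noteq> {}\<close> in auto)
    then show ?thesis by (auto simp: S'_def)
  qed
  have S'_step: "s q (a q r) = 0 \<and> (\<forall>q'. 0 < P q (a q r) q' \<longrightarrow> (q', prev r (a q r)) \<in> S')"
    if "(q, r) \<in> S'" for q r
  proof -
    have S: "(q, r) \<in> S" and r: "r < c" and m: "L q r = m" using that by (auto simp: S'_def S_def)
    have succ: "m \<le> L q' (prev r (a q r))" if "0 < P q (a q r) q'" for q'
      using m_le S_closed[OF S that] by blast
    have ge: "m \<le> avg q (a q r) (\<lambda>i. L i (prev r (a q r)))" by (rule avg_ge[OF a[OF r]]) (rule succ)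
    then have zero: "s q (a q r) = 0" using s[OF a[OF r]] a_le[OF r, of q] m by (simp add: order_antisym)
    have "L q' (prev r (a q r)) = m" if "0 < P q (a q r) q'" for q'
      by (rule avg_min_attained[where f = "\<lambda>i. L i (prev r (a q r))", OF a[OF r]])
        (use succ a_le[OF r, of q] zero m that in auto)
    then show ?thesis using zero S_closed[OF S] by (auto simp: S'_def)
  qed
  have "finite S'" by (rule finite_subset[OF _ \<open>finite S\<close>]) (auto simp: S'_def)
  moreover have "y \<in> S'" if "x \<in> S'" "(x, y) \<in> G" for x y
    using that S'_step unfolding G_def by blast
  ultimately have "\<exists>x\<in>S'. \<forall>y. (x, y) \<in> G\<^sup>* \<longrightarrow> y \<in> S' \<and> (y, x) \<in> G\<^sup>*"
    using \<open>S' \<noteq> {}\<close> by (intro exists_recurrent_point)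
  then obtain x where x: "x \<in> S'" and rec: "\<And>y. (x, y) \<in> G\<^sup>* \<Longrightarrow> y \<in> S' \<and> (y, x) \<in> G\<^sup>*"
    by blast
  define Z where "Z = {(q, a q r) | q r. (x, (q, r)) \<in> G\<^sup>*}"
  have "\<Delta> \<le> 0"
  proof -
    have path: "(fst y, fst z) \<in> (edges Z)\<^sup>*" if "(y, z) \<in> G\<^sup>*" "(x, y) \<in> G\<^sup>*" for y z
      using that
    proof induction
      case (step z w)
      then have "(x, z) \<in> G\<^sup>*" by (intro rtrancl_trans[of x y G z])
      then have "(fst z, a (fst z) (snd z)) \<in> Z"
        unfolding Z_def by (intro CollectI exI[of _ "fst z"] exI[of _ "snd z"]) simp
      moreover have "0 < P (fst z) (a (fst z) (snd z)) (fst w)"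
        using step(2) by (simp add: G_def split: prod.splits)
      ultimately have "(fst z, fst w) \<in> edges Z" unfolding edges_def by blast
      then show ?case using step.IH[OF step.prems] by (rule rtrancl_into_rtrancl[rotated])
    qed simp
    have "recurrent Z"
      unfolding recurrent_def
    proof (intro ballI, clarify)
      fix q p assume "(q, p) \<in> Z"
      then obtain r where r: "p = a q r" "(x, (q, r)) \<in> G\<^sup>*" by (auto simp: Z_def)
      then have "r < c" using rec by (auto simp: S'_def S_def)
      moreover have "(q', q) \<in> (edges Z)\<^sup>*" if "0 < P q p q'" for q'
      proof -
        have "((q, r), (q', prev r p)) \<in> G" using r(1) that by (simp add: G_def)
        with r(2) have y: "(x, (q', prev r p)) \<in> G\<^sup>*" by (rule rtrancl_into_rtrancl)
        then have "((q', prev r p), (q, r)) \<in> G\<^sup>*" using rec[OF y] r(2) by (blast intro: rtrancl_trans)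
        then show ?thesis using path[OF _ y, of "(q, r)"] by simp
      qed
      ultimately show "p \<in> A q \<and> (\<forall>q'. 0 < P q p q' \<longrightarrow> (q', q) \<in> (edges Z)\<^sup>*)" using a r by blast
    qed
    moreover have "\<forall>(q, p)\<in>Z. s q p = 0" using rec S'_step by (auto simp: Z_def)
    ultimately have "Z \<subseteq> critical s" unfolding critical_def by blast
    obtain q r where qr: "x = (q, r)" by (cases x)
    have "(q, a q r) \<in> Z" by (auto simp: Z_def qr)
    then have q: "q \<in> fst ` critical s" using \<open>Z \<subseteq> critical s\<close> by force
    have r: "r < c" and gap: "U q r - L q r = \<Delta>" using x by (auto simp: S'_def S_def qr gap_def)
    have sub: "u k q \<le> avg q p (u (k - \<tau> p))" if "K \<le> k" "(q, p) \<in> critical s" for k q p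
    proof -
      have "s q p = 0" "p \<in> A q"
        using that(2) recurrent_action[OF recurrent_critical] by (auto simp: critical_def)
      then show ?thesis using dynamics[OF that(1), of q] by (auto simp: bellman_def)
    qed
    obtain i where i: "(q, i) \<in> (edges (critical s))\<^sup>*" "walk (critical s) i c i"
      using loops[OF q] by blast
    have "convergent (\<lambda>j. u (r + j * c) q)"
      using recurrent_critical sub bounded delays c q i by (rule converges_on_recurrent)
    then obtain l where l: "(\<lambda>j. u (r + j * c) q) \<longlonglongrightarrow> l" by (auto simp: convergent_def)
    have ev: "\<exists>N. \<forall>k\<ge>N. k mod c = r \<longrightarrow> \<bar>u k q - l\<bar> < \<epsilon>" if "0 < \<epsilon>" for \<epsilon>
    proof -
      obtain N where N: "\<And>j. N \<le> j \<Longrightarrow> \<bar>u (r + j * c) q - l\<bar> < \<epsilon>"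
        using LIMSEQ_D[OF l \<open>0 < \<epsilon>\<close>] by auto
      have "\<bar>u k q - l\<bar> < \<epsilon>" if "N * c \<le> k" "k mod c = r" for k
      proof -
        have "N \<le> k div c" using div_le_mono[OF that(1), of c] c by simp
        moreover have "k = r + (k div c) * c" using that(2) by (metis add.commute div_mult_mod_eq)
        ultimately show ?thesis using N[of "k div c"] by simp
      qed
      then show ?thesis by blast
    qed
    have "U q r \<le> L q r"
    proof (rule field_le_epsilon)
      fix \<epsilon> :: real assume "0 < \<epsilon>"
      then have \<epsilon>: "0 < \<epsilon> / 4" by simp
      obtain N where N: "\<And>k. N \<le> k \<Longrightarrow> k mod c = r \<Longrightarrow> \<bar>u k q - l\<bar> < \<epsilon> / 4"
        using ev[OF \<epsilon>] by blast
      obtain k where "N \<le> k" "k mod c = r" "U q r - \<epsilon> / 4 \<le> u k q"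
        using U_fr[OF \<epsilon> r, of N q] by blast
      moreover obtain k' where "N \<le> k'" "k' mod c = r" "u k' q \<le> L q r + \<epsilon> / 4"
        using L_fr[OF \<epsilon> r, of N q] by blast
      ultimately show "U q r \<le> L q r + \<epsilon>" using N[of k] N[of k'] by linarith
    qed
    then show ?thesis using gap by simp
  qed
  have "(\<lambda>j. u (k0 + j * c) q0) \<longlonglongrightarrow> U q0 (k0 mod c)"
  proof (rule LIMSEQ_I)
    fix \<epsilon> :: real assume "0 < \<epsilon>"
    then have \<epsilon>: "0 < \<epsilon> / 2" by simp
    obtain N where N: "\<And>k. N \<le> k \<Longrightarrow>
        u k q0 \<le> U q0 (k mod c) + \<epsilon> / 2 \<and> L q0 (k mod c) - \<epsilon> / 2 \<le> u k q0"
      using eventually_conj[OF U_ev[OF \<epsilon>, of q0] L_ev[OF \<epsilon>, of q0]]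
      unfolding eventually_sequentially by blast
    have "U q0 (k0 mod c) - L q0 (k0 mod c) \<le> 0"
      using gap_le[of "k0 mod c" q0] \<open>\<Delta> \<le> 0\<close> c by (simp add: gap_def)
    moreover have "N \<le> k0 + j * c" if "N \<le> j" for j
      using that c by (metis le_add2 le_trans mult.right_neutral mult_le_mono2 trans_le_add2)
    moreover have "(k0 + j * c) mod c = k0 mod c" for j by simp
    ultimately have "\<bar>u (k0 + j * c) q0 - U q0 (k0 mod c)\<bar> < \<epsilon>" if "N \<le> j" for j
      using N[of "k0 + j * c"] that \<open>0 < \<epsilon>\<close> by fastforce
    then show "\<exists>no. \<forall>j\<ge>no. norm (u (k0 + j * c) q0 - U q0 (k0 mod c)) < \<epsilon>" by auto
  qed
  then show ?thesis by (rule convergentI)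
qed

end

section \<open>Periods as orders of permutations\<close>

text \<open>
  The permutation rotates disjoint blocks of the given lengths.
\<close>

lemma permutation_with_cycle_lengths:
  fixes len :: "'i \<Rightarrow> nat"
  assumes "finite I" and pos: "\<And>i. i \<in> I \<Longrightarrow> 1 \<le> len i" and sum: "(\<Sum>i\<in>I. len i) \<le> n"
  shows "\<exists>\<sigma>\<in>carrier (sym_group n). \<forall>i\<in>I. len i dvd group.ord (sym_group n) \<sigma>"
proof -
  interpret sym: group "sym_group n" by (rule sym_group_is_group)
  define S where "S = (SIGMA i:I. {..<len i})"
  have "finite S" unfolding S_def using \<open>finite I\<close> by auto
  have "card S = (\<Sum>i\<in>I. len i)" unfolding S_def using \<open>finite I\<close> by (subst card_SigmaI) auto
  then obtain f where f: "f ` S \<subseteq> {1..n}" "inj_on f S"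
    using card_le_inj[of S "{1..n}"] \<open>finite S\<close> sum by auto
  define rot where "rot = (\<lambda>(i, j). if (i, j) \<in> S then (i, Suc j mod len i) else (i, j))"
  have rot: "rot (i, j) = (i, Suc j mod len i)" if "(i, j) \<in> S" for i j using that by (simp add: rot_def)
  have rot_in: "rot x \<in> S" if "x \<in> S" for x
    using that pos by (cases x) (auto simp: rot S_def intro!: mod_less_divisor)
  have "inj_on rot S"
  proof (rule inj_onI)
    fix x y assume "x \<in> S" "y \<in> S" "rot x = rot y"
    then show "x = y"
      by (cases x, cases y) (auto simp: rot S_def mod_Suc split: if_splits)
  qed
  then have "bij_betw rot S S"
    unfolding bij_betw_def using endo_inj_surj[OF \<open>finite S\<close>, of rot] rot_in by blast
  then have "rot permutes S"
    by (rule bij_imp_permutes) (auto simp: rot_def)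
  define \<sigma> where "\<sigma> = map_permutation S f rot"
  have "\<sigma> permutes f ` S"
    unfolding \<sigma>_def using \<open>rot permutes S\<close> f(2) by (intro map_permutation_permutes) (auto simp: bij_betw_def)
  then have carrier: "\<sigma> \<in> carrier (sym_group n)"
    unfolding sym_group_carrier using f(1) by (rule permutes_subset)
  have \<sigma>: "\<sigma> (f x) = f (rot x)" if "x \<in> S" for x
    using that f(2) by (simp add: \<sigma>_def map_permutation_def restrict_id_def)
  have iterate: "(\<sigma> ^^ k) (f (i, 0)) = f (i, k mod len i)" if "i \<in> I" for i k
  proof (induction k)
    case (Suc k)
    have "(i, k mod len i) \<in> S" using pos[OF that] that by (auto simp: S_def)
    then show ?case using Suc by (simp add: \<sigma> rot mod_Suc_eq)
  qed simp
  have pow: "\<sigma> [^]\<^bsub>sym_group n\<^esub> k = \<sigma> ^^ k" for k :: nat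
    by (induction k) (simp_all add: sym_group_one sym_group_mult funpow_Suc_right del: funpow.simps(2))
  have "len i dvd sym.ord \<sigma>" if i: "i \<in> I" for i
  proof -
    have "\<sigma> ^^ sym.ord \<sigma> = id"
      using sym.pow_ord_eq_1[OF carrier] by (simp add: pow sym_group_one)
    then have "f (i, sym.ord \<sigma> mod len i) = f (i, 0)" using iterate[OF i, of "sym.ord \<sigma>"] by simp
    moreover have "(i, sym.ord \<sigma> mod len i) \<in> S" "(i, 0) \<in> S"
      using pos[OF i] i by (auto simp: S_def)
    ultimately have "sym.ord \<sigma> mod len i = 0" using f(2) by (auto dest: inj_onD)
    then show ?thesis by auto
  qed
  then show ?thesis using carrier by blast
qed

context delayed_decision_process
begin

text \<open>
  Following one chosen successor per transition, a walk inside a class \<open>X\<close> closes up after at most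
  \<open>card X\<close> steps, each of delay at most \<open>T\<close>. The classes are disjoint, whence the bound on the sum.
\<close>

lemma closed_walk_lengths:
  assumes Z: "recurrent Z" and delays: "\<And>p. \<tau> p \<le> T"
  shows "\<exists>(I :: 'q set set) len. (\<forall>X\<in>I. 1 \<le> len X) \<and> (\<Sum>X\<in>I. len X) \<le> CARD('q) * T \<and>
    (\<forall>q\<in>fst ` Z. \<exists>X\<in>I. \<exists>i. (q, i) \<in> (edges Z)\<^sup>* \<and> walk Z i (len X) i)"
proof -
  define R where "R = (edges Z)\<^sup>*"
  have "equiv UNIV R"
    unfolding R_def using recurrent_sym[OF Z] by (intro equivI refl_rtrancl trans_rtrancl) auto
  have "\<forall>q\<in>fst ` Z. \<exists>p q'. (q, p) \<in> Z \<and> 0 < P q p q'"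
    using exists_successor recurrent_action[OF Z] by fastforce
  then obtain a f where af: "\<And>q. q \<in> fst ` Z \<Longrightarrow> (q, a q) \<in> Z \<and> 0 < P q (a q) (f q)" by metis
  have f: "f q \<in> fst ` Z" if q: "q \<in> fst ` Z" for q
  proof -
    have "(f q, q) \<in> (edges Z)\<^sup>*" using Z af[OF q] by (auto simp: recurrent_def)
    then show ?thesis
    proof (cases rule: converse_rtranclE)
      case base
      then show ?thesis using q by simp
    next
      case (step y)
      then show ?thesis by (force simp: edges_def)
    qed
  qed
  have fn: "(f ^^ m) q \<in> fst ` Z" if "q \<in> fst ` Z" for m q
    using that by (induction m) (auto simp: f)
  have fwalk: "walk Z q (\<Sum>m<n. \<tau> (a ((f ^^ m) q))) ((f ^^ n) q)" if q: "q \<in> fst ` Z" for q n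
  proof (induction n)
    case 0
    show ?case by (simp add: walk_refl)
  next
    case (Suc n)
    have "walk Z ((f ^^ n) q) (\<tau> (a ((f ^^ n) q)) + 0) (f ((f ^^ n) q))"
      using af[OF fn[OF q, of n]] by (intro walk_step) (auto intro: walk_refl)
    then show ?case using walk_trans[OF Suc] by simp
  qed
  have fdepth: "depth ((f ^^ m) q) + m \<le> depth q"
    if "q \<in> fst ` Z" "\<forall>j<m. \<tau> (a ((f ^^ j) q)) = 0" for m q
    using that(2)
  proof (induction m)
    case (Suc m)
    have "depth (f ((f ^^ m) q)) < depth ((f ^^ m) q)"
      using af[OF fn[OF that(1), of m]] recurrent_action[OF Z] Suc.prems by (intro depth_decreasing) auto
    then show ?case using Suc by fastforce
  qed simp
  define I where "I = (\<lambda>q. R `` {q}) ` (fst ` Z)"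
  have "\<forall>X\<in>I. \<exists>h. 1 \<le> h \<and> h \<le> card X * T \<and> (\<exists>i\<in>X. walk Z i h i)"
  proof
    fix X assume "X \<in> I"
    then obtain q where q: "q \<in> fst ` Z" and X: "X = R `` {q}" by (auto simp: I_def)
    have X_in: "(f ^^ m) q \<in> X" for m
      unfolding X R_def using walk_rtrancl[OF fwalk[OF q, of m]] by auto
    have "\<not> inj_on (\<lambda>m. (f ^^ m) q) {..card X}"
    proof
      assume "inj_on (\<lambda>m. (f ^^ m) q) {..card X}"
      then have "card {..card X} \<le> card X"
        using X_in by (intro card_inj_on_le[where f = "\<lambda>m. (f ^^ m) q"]) auto
      then show False by simp
    qed
    then obtain i j where ij: "i < j" "j \<le> card X" "(f ^^ i) q = (f ^^ j) q"
      unfolding inj_on_def by (metis atMost_iff linorder_neqE_nat)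
    define y where "y = (f ^^ i) q"
    have y: "y \<in> fst ` Z" "y \<in> X" using fn[OF q] X_in by (auto simp: y_def)
    have closed: "(f ^^ (j - i)) y = y"
      using ij by (metis y_def funpow_add le_add_diff_inverse2 less_imp_le o_apply)
    define h where "h = (\<Sum>m<j - i. \<tau> (a ((f ^^ m) y)))"
    have "walk Z y h y" using fwalk[OF y(1), of "j - i"] by (simp add: h_def closed)
    moreover have "1 \<le> h"
    proof (rule ccontr)
      assume "\<not> 1 \<le> h"
      then have "h = 0" by simp
      then have "\<forall>m<j - i. \<tau> (a ((f ^^ m) y)) = 0" by (simp add: h_def)
      then have "depth ((f ^^ (j - i)) y) + (j - i) \<le> depth y" by (rule fdepth[OF y(1)])
      then show False using closed ij(1) by simp
    qed
    moreover have "h \<le> card X * T"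
    proof -
      have "h \<le> (j - i) * T" unfolding h_def using sum_bounded_above[of "{..<j - i}" _ T] delays by simp
      also have "\<dots> \<le> card X * T" using ij by (intro mult_le_mono1) simp
      finally show ?thesis .
    qed
    ultimately show "\<exists>h. 1 \<le> h \<and> h \<le> card X * T \<and> (\<exists>i\<in>X. walk Z i h i)" using y(2) by blast
  qed
  then obtain len where len: "\<And>X. X \<in> I \<Longrightarrow> 1 \<le> len X \<and> len X \<le> card X * T \<and> (\<exists>i\<in>X. walk Z i (len X) i)"
    by metis
  have "I \<subseteq> UNIV // R" by (auto simp: I_def quotient_def)
  then have disj: "pairwise disjnt I"
    using quotient_disj[OF \<open>equiv UNIV R\<close>] unfolding pairwise_def disjnt_def by blast
  have "(\<Sum>X\<in>I. len X) \<le> (\<Sum>X\<in>I. card X * T)" by (rule sum_mono) (use len in blast)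
  also have "\<dots> = card (\<Union>I) * T"
    by (subst card_Union_disjoint[OF disj]) (simp_all add: sum_distrib_right)
  also have "\<dots> \<le> CARD('q) * T" by (intro mult_le_mono1 card_mono) auto
  finally have "(\<Sum>X\<in>I. len X) \<le> CARD('q) * T" .
  moreover have "\<exists>X\<in>I. \<exists>i. (q, i) \<in> (edges Z)\<^sup>* \<and> walk Z i (len X) i" if "q \<in> fst ` Z" for q
  proof -
    have "R `` {q} \<in> I" using that by (auto simp: I_def)
    then show ?thesis using len[of "R `` {q}"] by (auto simp: R_def)
  qed
  ultimately show ?thesis using len by blast
qed

end

section \<open>Orbits relative to their drift\<close>

context delayed_decision_process
begin

text \<open>
  An action \<open>p\<close> with \<open>avg q p \<rho> > \<rho> q\<close> becomes ever more expensive compared with an optimal one,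
  so it is not used after some time. The remaining actions form a decision process of their own,
  in which the distance to the half-line is a bounded orbit with nonnegative costs.
\<close>

theorem orbit_minus_drift_periodic:
  fixes X :: "nat \<Rightarrow> 'q \<Rightarrow> real" and \<rho> v :: "'q \<Rightarrow> real" and r :: "'q \<Rightarrow> 'p \<Rightarrow> real"
  assumes sup: "\<And>q p. p \<in> A q \<Longrightarrow> \<rho> q \<le> avg q p \<rho>"
    and le: "\<And>q p. p \<in> A q \<Longrightarrow> avg q p \<rho> = \<rho> q \<Longrightarrow> v q + \<tau> p * \<rho> q \<le> r q p + avg q p v"
    and ex: "\<And>q. \<exists>p\<in>A q. avg q p \<rho> = \<rho> q \<and> v q + \<tau> p * \<rho> q = r q p + avg q p v"
    and delays: "\<And>p. \<tau> p \<le> T"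
    and bounded: "\<And>k q. \<bar>X k q - \<rho> q * k\<bar> \<le> C"
    and dynamics: "\<And>k q. K \<le> k \<Longrightarrow> bellman r (\<lambda>p. X (k - \<tau> p)) q (X k q)"
  shows "\<exists>(I :: 'q set set) len. (\<forall>Y\<in>I. 1 \<le> len Y) \<and> (\<Sum>Y\<in>I. len Y) \<le> CARD('q) * T \<and>
    (\<forall>c\<ge>1. (\<forall>Y\<in>I. len Y dvd c) \<longrightarrow>
      (\<forall>k0 q. convergent (\<lambda>j. X (k0 + j * c) q - \<rho> q * real (k0 + j * c))))"
proof -
  define A' where "A' q = {p \<in> A q. avg q p \<rho> = \<rho> q}" for q
  interpret active: delayed_decision_process A' P \<tau> depth
  proof
    fix q show "finite (A' q)" using actions_finite[of q] by (simp add: A'_def)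
    show "A' q \<noteq> {}" using ex[of q] by (auto simp: A'_def)
  qed (auto simp: A'_def P_nonneg P_sum depth_decreasing)
  define s where "s q p = r q p + avg q p v - v q - \<tau> p * \<rho> q" for q p
  have s: "0 \<le> s q p" if "p \<in> A' q" for q p
    using le[of p q] that by (simp add: s_def A'_def)
  define u where "u k q = X k q - \<rho> q * k - v q" for k q
  have avg_X: "avg q p (X j) = avg q p (u j) + avg q p \<rho> * j + avg q p v" for q p j
  proof -
    have "X j = (\<lambda>i. u j i + real j * \<rho> i + v i)" by (simp add: u_def fun_eq_iff)
    then show ?thesis by (simp add: avg_add avg_cmult)
  qed
  have "\<forall>\<^sub>F k in sequentially. \<forall>q. \<forall>p\<in>A q. p \<notin> A' q \<longrightarrow> X k q < r q p + avg q p (X (k - \<tau> p))"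
  proof (intro eventually_all_finite eventually_ball_finite actions_finite ballI)
    fix q p assume p: "p \<in> A q"
    show "\<forall>\<^sub>F k in sequentially. p \<notin> A' q \<longrightarrow> X k q < r q p + avg q p (X (k - \<tau> p))"
    proof (cases "p \<in> A' q")
      case False
      define \<gamma> where "\<gamma> = avg q p \<rho> - \<rho> q"
      have \<gamma>: "0 < \<gamma>" using sup[OF p] False p by (auto simp: \<gamma>_def A'_def)
      define d where "d = 2 * C - r q p + avg q p \<rho> * \<tau> p"
      obtain k1 :: nat where k1: "d / \<gamma> < k1" using reals_Archimedean2 by blast
      have "X k q < r q p + avg q p (X (k - \<tau> p))" if k: "max k1 T \<le> k" for k
      proof -
        have "d < \<gamma> * k1" using k1 \<gamma> by (simp add: pos_divide_less_eq mult.commute)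
        also have "\<dots> \<le> \<gamma> * k" using \<gamma> k by simp
        finally have d: "d < \<gamma> * k" .
        have "avg q p (\<lambda>i. real (k - \<tau> p) * \<rho> i - C) \<le> avg q p (X (k - \<tau> p))"
        proof (rule avg_mono[OF p])
          fix i show "real (k - \<tau> p) * \<rho> i - C \<le> X (k - \<tau> p) i"
            using bounded[of "k - \<tau> p" i] by (simp add: abs_le_iff mult.commute)
        qed
        then have "real (k - \<tau> p) * avg q p \<rho> - C \<le> avg q p (X (k - \<tau> p))"
          by (simp add: avg_diff avg_cmult avg_const[OF p])
        moreover have "real (k - \<tau> p) = real k - real (\<tau> p)"
          using k delays[of p] by (intro of_nat_diff) simp
        moreover have "X k q \<le> \<rho> q * k + C" using bounded[of k q] by linarith
        ultimately show ?thesis using d by (simp add: d_def \<gamma>_def algebra_simps)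
      qed
      then show ?thesis by (intro eventually_sequentiallyI[of "max k1 T"]) blast
    qed simp
  qed
  then obtain k1 where inactive: "\<And>k q p. k1 \<le> k \<Longrightarrow> p \<in> A q \<Longrightarrow> p \<notin> A' q \<Longrightarrow>
      X k q < r q p + avg q p (X (k - \<tau> p))"
    unfolding eventually_sequentially by blast
  have u_bounded: "\<bar>u k q\<bar> \<le> C + (\<Sum>i\<in>UNIV. \<bar>v i\<bar>)" for k q
  proof -
    have "\<bar>v q\<bar> \<le> (\<Sum>i\<in>UNIV. \<bar>v i\<bar>)" by (rule member_le_sum) auto
    then show ?thesis using bounded[of k q] unfolding u_def by linarith
  qed
  have u_dynamics: "active.bellman s (\<lambda>p. u (k - \<tau> p)) q (u k q)" if k: "max k1 (max K T) \<le> k" for k q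
  proof -
    have shift: "r q p + avg q p (X (k - \<tau> p)) = s q p + avg q p (u (k - \<tau> p)) + \<rho> q * k + v q"
      if "p \<in> A' q" for p
    proof -
      have "real (k - \<tau> p) = real k - real (\<tau> p)"
        using k delays[of p] by (intro of_nat_diff) simp
      then show ?thesis using that by (simp add: avg_X s_def A'_def algebra_simps)
    qed
    have X: "bellman r (\<lambda>p. X (k - \<tau> p)) q (X k q)" using dynamics k by simp
    then obtain p where p: "p \<in> A q" "X k q = r q p + avg q p (X (k - \<tau> p))"
      by (auto simp: bellman_def)
    then have "p \<in> A' q" using inactive[of k p q] k by fastforce
    then have "u k q = s q p + avg q p (u (k - \<tau> p))" using p(2) shift by (simp add: u_def)
    moreover have "u k q \<le> s q p + avg q p (u (k - \<tau> p))" if "p \<in> A' q" for p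
      using X shift[OF that] that by (auto simp: u_def bellman_def A'_def)
    ultimately show ?thesis using \<open>p \<in> A' q\<close> unfolding active.bellman_def by blast
  qed
  obtain I :: "'q set set" and len where len: "\<forall>Y\<in>I. 1 \<le> len Y" "(\<Sum>Y\<in>I. len Y) \<le> CARD('q) * T"
    and walks: "\<forall>q\<in>fst ` active.critical s. \<exists>Y\<in>I. \<exists>i. (q, i) \<in> (active.edges (active.critical s))\<^sup>* \<and>
      active.walk (active.critical s) i (len Y) i"
    using active.closed_walk_lengths[OF active.recurrent_critical delays] by metis
  have "convergent (\<lambda>j. X (k0 + j * c) q - \<rho> q * real (k0 + j * c))"
    if c: "1 \<le> c" and dvd: "\<forall>Y\<in>I. len Y dvd c" for c k0 q
  proof -
    have loops: "\<exists>i. (q, i) \<in> (active.edges (active.critical s))\<^sup>* \<and> active.walk (active.critical s) i c i"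
      if q: "q \<in> fst ` active.critical s" for q
    proof -
      obtain Y i where i: "Y \<in> I" "(q, i) \<in> (active.edges (active.critical s))\<^sup>*"
          "active.walk (active.critical s) i (len Y) i"
        using walks q by blast
      obtain n where "c = n * len Y" using dvd i(1) by (metis dvdE mult.commute)
      then show ?thesis using i active.walk_repeat by blast
    qed
    have "convergent (\<lambda>j. u (k0 + j * c) q)"
      using s u_dynamics u_bounded delays c loops by (rule active.bounded_orbit_periodic)
    then have "convergent (\<lambda>j. u (k0 + j * c) q + v q)" by (intro convergent_add convergent_const)
    then show ?thesis by (simp add: u_def)
  qed
  then show ?thesis using len by blast
qed

end

section \<open>The decision process of a net\<close>

definition zero_delay_arcs :: "('p, 'q) petri_net \<Rightarrow> 'q rel" where
  "zero_delay_arcs N =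
     {(q', q). \<exists>p. (p, q) \<in> place_arcs N \<and> (q', p) \<in> transition_arcs N \<and> holding_time N p = 0}"

text \<open>
  Without circuits of zero delay, the number of ancestors along arcs of zero delay is a depth.
\<close>

definition zero_delay_depth :: "('p, 'q) petri_net \<Rightarrow> 'q \<Rightarrow> nat" where
  "zero_delay_depth N q = card {q'. (q', q) \<in> (zero_delay_arcs N)\<^sup>+}"

lemma zero_delay_path:
  assumes "(a, b) \<in> (zero_delay_arcs N)\<^sup>+"
  shows "\<exists>xs. xs \<noteq> [] \<and> hd xs = Inr a \<and> successively (\<lambda>x y. (x, y) \<in> net_arcs N) xs \<and>
    (last xs, Inr b) \<in> net_arcs N \<and> (\<forall>p. Inl p \<in> set xs \<longrightarrow> holding_time N p = 0)"
  using assms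
proof induction
  case (base b)
  then obtain p where "(p, b) \<in> place_arcs N" "(a, p) \<in> transition_arcs N" "holding_time N p = 0"
    by (auto simp: zero_delay_arcs_def)
  then show ?case by (intro exI[of _ "[Inr a, Inl p]"]) (auto simp: net_arcs_def)
next
  case (step b c)
  then obtain xs where xs: "xs \<noteq> []" "hd xs = Inr a" "successively (\<lambda>x y. (x, y) \<in> net_arcs N) xs"
      "(last xs, Inr b) \<in> net_arcs N" "\<forall>p. Inl p \<in> set xs \<longrightarrow> holding_time N p = 0"
    by blast
  obtain p where "(p, c) \<in> place_arcs N" "(b, p) \<in> transition_arcs N" "holding_time N p = 0"
    using step(2) by (auto simp: zero_delay_arcs_def)
  then show ?case
    using xs by (intro exI[of _ "xs @ [Inr b, Inl p]"])
      (auto simp: successively_append_iff net_arcs_def)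
qed

lemma acyclic_zero_delay_arcs:
  assumes "non_Zeno N"
  shows "acyclic (zero_delay_arcs N)"
  unfolding acyclic_def
proof (intro allI notI)
  fix q assume cycle: "(q, q) \<in> (zero_delay_arcs N)\<^sup>+"
  obtain xs where xs: "xs \<noteq> []" "hd xs = Inr q" "successively (\<lambda>x y. (x, y) \<in> net_arcs N) xs"
      "(last xs, Inr q) \<in> net_arcs N" "\<forall>p. Inl p \<in> set xs \<longrightarrow> holding_time N p = 0"
    using zero_delay_path[OF cycle] by blast
  have "(xs ! i, xs ! (Suc i mod length xs)) \<in> net_arcs N" if i: "i < length xs" for i
  proof (cases "Suc i < length xs")
    case True
    then show ?thesis using xs(3) by (simp add: successively_conv_nth)
  next
    case False
    then have len: "length xs = Suc i" using i by simp
    then have "xs ! i = last xs" "xs ! 0 = Inr q"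
      using xs(1,2) by (simp_all add: last_conv_nth hd_conv_nth)
    then show ?thesis using xs(4) by (simp add: len)
  qed
  then have "directed_circuit N xs" using xs(1) by (simp add: directed_circuit_def)
  then show False using assms xs(5) unfolding non_Zeno_def by blast
qed

lemma zero_delay_depth_less:
  fixes N :: "('p, 'q::finite) petri_net"
  assumes "non_Zeno N" "(q', q) \<in> zero_delay_arcs N"
  shows "zero_delay_depth N q' < zero_delay_depth N q"
  unfolding zero_delay_depth_def
proof (rule psubset_card_mono)
  have "q' \<notin> {x. (x, q') \<in> (zero_delay_arcs N)\<^sup>+}"
    using acyclic_zero_delay_arcs[OF assms(1)] by (simp add: acyclic_def)
  moreover have "{x. (x, q') \<in> (zero_delay_arcs N)\<^sup>+} \<subseteq> {x. (x, q) \<in> (zero_delay_arcs N)\<^sup>+}"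
    using assms(2) by (auto intro: trancl_into_trancl)
  ultimately show "{x. (x, q') \<in> (zero_delay_arcs N)\<^sup>+} \<subset> {x. (x, q) \<in> (zero_delay_arcs N)\<^sup>+}"
    using assms(2) by blast
qed simp

text \<open>
  The weights of the dynamics in the coordinates \<open>z q / e q\<close>: the invariant makes them sum to one.
\<close>

definition transition_probability :: "('p, 'q::finite) petri_net \<Rightarrow> real ^ 'q \<Rightarrow> 'q \<Rightarrow> 'p \<Rightarrow> 'q \<Rightarrow> real" where
  "transition_probability N e q p q' =
     (if q' \<in> upstream_transitions N p
      then routing N q p * inverse (place_weight N q p) * transition_weight N p q' * e $ q' / e $ q
      else 0)"

definition action_cost :: "('p, 'q::finite) petri_net \<Rightarrow> real ^ 'q \<Rightarrow> 'q \<Rightarrow> 'p \<Rightarrow> real" where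
  "action_cost N e q p = routing N q p * inverse (place_weight N q p) * marking N p / e $ q"

definition delay :: "('p, 'q) petri_net \<Rightarrow> 'p \<Rightarrow> nat" where
  "delay N p = nat \<lfloor>holding_time N p\<rfloor>"

lemma real_delay:
  "0 \<le> holding_time N p \<Longrightarrow> holding_time N p \<in> \<int> \<Longrightarrow> real (delay N p) = holding_time N p"
  by (auto simp: delay_def elim!: Ints_cases)

lemma sum_transition_probability:
  fixes N :: "('p::finite, 'q::finite) petri_net"
  shows "(\<Sum>q'\<in>UNIV. transition_probability N e q p q' * f q') =
    routing N q p * inverse (place_weight N q p) *
      (\<Sum>q'\<in>upstream_transitions N p. transition_weight N p q' * (e $ q' * f q')) / e $ q"
proof -
  have "(\<Sum>q'\<in>UNIV. transition_probability N e q p q' * f q') =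
    (\<Sum>q'\<in>UNIV. if q' \<in> upstream_transitions N p
       then routing N q p * inverse (place_weight N q p) / e $ q *
         (transition_weight N p q' * (e $ q' * f q')) else 0)"
    by (rule sum.cong) (auto simp: transition_probability_def)
  also have "\<dots> = (\<Sum>q'\<in>upstream_transitions N p. routing N q p * inverse (place_weight N q p) / e $ q *
         (transition_weight N p q' * (e $ q' * f q')))"
    by (subst sum.inter_restrict[symmetric]) auto
  finally show ?thesis unfolding sum_distrib_left[symmetric] by simp
qed

lemma delayed_decision_process_net:
  fixes N :: "('p::finite, 'q::finite) petri_net"
  assumes net: "fluid_net_without_priority N" and "non_Zeno N"
    and inv: "stoichiometric_invariant N e" and e: "\<forall>q. 0 < e $ q"
    and int: "\<forall>p. holding_time N p \<in> \<int>"
  shows "delayed_decision_process (upstream_places N) (transition_probability N e) (delay N)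
    (zero_delay_depth N)"
proof
  fix p q q'
  show "upstream_places N q \<noteq> {}" using net by (simp add: fluid_net_without_priority_def)
  assume p: "p \<in> upstream_places N q"
  then have arc: "(p, q) \<in> place_arcs N" by (simp add: upstream_places_def)
  have "preselection_place N p \<or> single_output_place N p"
    using net by (simp add: fluid_net_without_priority_def)
  moreover have "q \<in> downstream_transitions N p" using arc by (simp add: downstream_transitions_def)
  ultimately have "0 \<le> routing N q p"
    by (auto simp: preselection_place_def single_output_place_def)
  moreover have "\<forall>(p, q)\<in>place_arcs N. 0 < place_weight N q p"
    using net by (simp add: fluid_net_without_priority_def)
  then have "0 < place_weight N q p" using arc by auto
  moreover have "\<forall>(q, p)\<in>transition_arcs N. 0 < transition_weight N p q"
    using net by (simp add: fluid_net_without_priority_def)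
  then have "0 < transition_weight N p q'" if "q' \<in> upstream_transitions N p"
    using that by (auto simp: upstream_transitions_def)
  ultimately show "0 \<le> transition_probability N e q p q'"
    unfolding transition_probability_def using e by (auto simp: less_imp_le)
  have invariant: "routing N q p * inverse (place_weight N q p) *
      (\<Sum>q'\<in>upstream_transitions N p. transition_weight N p q' * e $ q') = e $ q"
    using inv p unfolding stoichiometric_invariant_def by simp
  have "(\<Sum>q'\<in>UNIV. transition_probability N e q p q') = e $ q / e $ q"
    using sum_transition_probability[of N e q p "\<lambda>_. 1"] by (simp only: mult_1_right invariant)
  then show "(\<Sum>q'\<in>UNIV. transition_probability N e q p q') = 1"
    using e by (simp add: less_imp_neq[THEN not_sym])
  assume "delay N p = 0" and pos: "0 < transition_probability N e q p q'"
  moreover have "0 \<le> holding_time N p" using net by (simp add: fluid_net_without_priority_def)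
  ultimately have "holding_time N p = 0" using real_delay int by (metis of_nat_0)
  moreover have "q' \<in> upstream_transitions N p"
    using pos by (auto simp: transition_probability_def split: if_splits)
  ultimately have "(q', q) \<in> zero_delay_arcs N"
    using arc by (auto simp: zero_delay_arcs_def upstream_transitions_def)
  then show "zero_delay_depth N q' < zero_delay_depth N q"
    by (rule zero_delay_depth_less[OF \<open>non_Zeno N\<close>])
qed simp

lemma trajectory_bellman:
  fixes N :: "('p::finite, 'q::finite) petri_net" and t :: real
  assumes process: "delayed_decision_process (upstream_places N) (transition_probability N e) (delay N)
      (zero_delay_depth N)"
    and e: "\<forall>q. 0 < e $ q"
    and delay: "\<And>p. real (delay N p) = holding_time N p"
    and z: "trajectory N z" and t: "0 < t"
  shows "delayed_decision_process.bellman (upstream_places N) (transition_probability N e)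
    (action_cost N e) (\<lambda>p q'. z (t - delay N p) $ q' / e $ q') q (z t $ q / e $ q)"
proof -
  interpret delayed_decision_process "upstream_places N" "transition_probability N e" "delay N"
    "zero_delay_depth N"
    by (rule process)
  define V where "V p = routing N q p * inverse (place_weight N q p) *
    (marking N p + (\<Sum>q'\<in>upstream_transitions N p.
       transition_weight N p q' * z (t - holding_time N p) $ q'))" for p
  have e_nonzero: "e $ q \<noteq> 0" for q using e by (simp add: less_imp_neq[THEN not_sym])
  have V: "V p / e $ q = action_cost N e q p +
      avg q p (\<lambda>q'. z (t - delay N p) $ q' / e $ q')" for p
    unfolding avg_def sum_transition_probability V_def action_cost_def delay
    by (simp add: e_nonzero add_divide_distrib distrib_left)
  have min: "z t $ q = (MIN p\<in>upstream_places N q. V p)"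
    using z t unfolding trajectory_def V_def by blast
  have "z t $ q \<le> V p" if "p \<in> upstream_places N q" for p
    unfolding min using that by (intro Min_le) auto
  moreover have "(MIN p\<in>upstream_places N q. V p) \<in> V ` upstream_places N q"
    using actions_nonempty by (intro Min_in) auto
  then have "\<exists>p\<in>upstream_places N q. z t $ q = V p" unfolding min by blast
  ultimately show ?thesis
    unfolding bellman_def V[symmetric] using e by (auto simp: divide_right_mono less_imp_le)
qed

lemma trajectory_initially_bounded:
  fixes N :: "('p::finite, 'q::finite) petri_net"
  assumes "trajectory N z" and e: "\<forall>q. 0 < e $ q"
  shows "\<exists>B. \<forall>t q. - max_holding_time N \<le> t \<longrightarrow> t \<le> 0 \<longrightarrow> \<bar>z t $ q / e $ q\<bar> \<le> B"
proof -
  have "compact (z ` {- max_holding_time N..0})"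
    using assms(1) by (intro compact_continuous_image) (auto simp: trajectory_def)
  then have "bounded (z ` {- max_holding_time N..0})" by (rule compact_imp_bounded)
  then obtain B where "\<forall>x\<in>z ` {- max_holding_time N..0}. norm x \<le> B"
    unfolding bounded_iff by blast
  then have B: "norm (z t) \<le> B" if "t \<in> {- max_holding_time N..0}" for t using that by blast
  have "\<bar>z t $ q / e $ q\<bar> \<le> \<bar>B\<bar> * (\<Sum>q\<in>UNIV. 1 / e $ q)"
    if "- max_holding_time N \<le> t" "t \<le> 0" for t q
  proof -
    have "\<bar>z t $ q\<bar> \<le> \<bar>B\<bar>" using B[of t] component_le_norm_cart[of "z t" q] that by auto
    moreover have "1 / e $ q \<le> (\<Sum>q\<in>UNIV. 1 / e $ q)"
      by (rule member_le_sum) (use e in \<open>auto simp: less_imp_le\<close>)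
    ultimately have "\<bar>z t $ q\<bar> * (1 / e $ q) \<le> \<bar>B\<bar> * (\<Sum>q\<in>UNIV. 1 / e $ q)"
      using e by (intro mult_mono) (auto simp: less_imp_le)
    then show ?thesis using e by (simp add: abs_divide abs_of_pos)
  qed
  then show ?thesis by (intro exI allI impI)
qed

text \<open>
  The hypothesis \<open>trajectory N z\<close> makes the limit unique: without any trajectory, every vector would
  satisfy the description that defines the throughput.
\<close>

lemma throughput_eqI:
  assumes z: "trajectory N z"
    and bounded: "\<And>z. trajectory N z \<Longrightarrow> \<exists>K. \<forall>t\<ge>0. \<forall>q. \<bar>z t $ q - t * R $ q\<bar> \<le> K"
  shows "throughput N = R"
proof -
  have lim: "((\<lambda>t. (1 / t) *\<^sub>R z t) \<longlongrightarrow> R) at_top"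
    if y: "trajectory N z" for z
  proof (rule vec_tendstoI)
    fix q
    obtain K where K: "\<And>t. 0 \<le> t \<Longrightarrow> \<bar>z t $ q - t * R $ q\<bar> \<le> K" using bounded[OF y] by blast
    have "((\<lambda>t. K / t) \<longlongrightarrow> 0) at_top"
      by (rule real_tendsto_divide_at_top[OF tendsto_const filterlim_ident])
    then have "((\<lambda>t. ((1 / t) *\<^sub>R z t) $ q - R $ q) \<longlongrightarrow> 0) at_top"
    proof (rule Lim_null_comparison[rotated])
      show "\<forall>\<^sub>F t in at_top. norm (((1 / t) *\<^sub>R z t) $ q - R $ q) \<le> K / t"
        using eventually_gt_at_top[of 0]
      proof eventually_elim
        case (elim t)
        have "((1 / t) *\<^sub>R z t) $ q - R $ q = (z t $ q - t * R $ q) / t"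
          using elim by (simp add: field_simps)
        then show ?case using K[of t] elim by (simp add: divide_right_mono)
      qed
    qed
    then show "((\<lambda>t. ((1 / t) *\<^sub>R z t) $ q) \<longlongrightarrow> R $ q) at_top" by (simp add: LIM_zero_iff)
  qed
  show ?thesis
    unfolding throughput_def
  proof (rule the_equality)
    show "\<forall>z. trajectory N z \<longrightarrow> ((\<lambda>t. (1 / t) *\<^sub>R z t) \<longlongrightarrow> R) at_top" using lim by blast
    fix R' assume "\<forall>z. trajectory N z \<longrightarrow> ((\<lambda>t. (1 / t) *\<^sub>R z t) \<longlongrightarrow> R') at_top"
    then have "((\<lambda>t. (1 / t) *\<^sub>R z t) \<longlongrightarrow> R') at_top" using z by blast
    then show "R' = R" by (rule tendsto_unique[OF trivial_limit_at_top_linorder _ lim[OF z]])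
  qed
qed

theorem corollary6p15:
  fixes N :: "('p::finite, 'q::finite) petri_net"
    and e :: "real ^ 'q"
    and T :: nat
    and z :: "real \<Rightarrow> real ^ 'q"
  assumes "fluid_net_without_priority N"
    and "non_Zeno N"
    and "stoichiometric_invariant N e"
    and "\<forall>q. 0 < e $ q"
    and "\<forall>p. holding_time N p \<in> \<int>"
    and "real T = max_holding_time N"
    and "trajectory N z"
  shows "\<exists>c::nat. 1 \<le> c \<and>
           (\<exists>\<sigma>\<in>carrier (sym_group (CARD('q) * T)). c = group.ord (sym_group (CARD('q) * T)) \<sigma>) \<and>
           (\<forall>r::nat. r \<le> c - 1 \<longrightarrow>
              convergent (\<lambda>t::nat. z (real (t * c + r)) - real (t * c + r) *\<^sub>R throughput N))"
proof -
  note e = assms(4)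
  have process: "delayed_decision_process (upstream_places N) (transition_probability N e) (delay N)
      (zero_delay_depth N)"
    using assms(1-5) by (rule delayed_decision_process_net)
  interpret delayed_decision_process "upstream_places N" "transition_probability N e" "delay N"
    "zero_delay_depth N"
    by (rule process)
  interpret sym: group "sym_group (CARD('q) * T)" by (rule sym_group_is_group)
  have delay: "real (delay N p) = holding_time N p" for p
    using assms(1,5) by (intro real_delay) (auto simp: fluid_net_without_priority_def)
  have delays: "delay N p \<le> T" for p
  proof -
    have "real (delay N p) \<le> real T"
      unfolding delay assms(6) max_holding_time_def by (rule Max_ge) auto
    then show ?thesis by simp
  qed
  obtain \<rho> v :: "'q \<Rightarrow> real" where half_line:
      "\<And>q p. p \<in> upstream_places N q \<Longrightarrow> \<rho> q \<le> avg q p \<rho>"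
      "\<And>q p. p \<in> upstream_places N q \<Longrightarrow> avg q p \<rho> = \<rho> q \<Longrightarrow>
        v q + delay N p * \<rho> q \<le> action_cost N e q p + avg q p v"
      "\<And>q. \<exists>p\<in>upstream_places N q. avg q p \<rho> = \<rho> q \<and>
        v q + delay N p * \<rho> q = action_cost N e q p + avg q p v"
    using invariant_half_line[of "action_cost N e"] by metis
  have deviation: "\<exists>K. \<forall>t\<ge>- real T. \<forall>q. \<bar>y t $ q / e $ q - \<rho> q * t\<bar> \<le> K" if y: "trajectory N y" for y
  proof -
    obtain B where B: "\<And>t q. - real T \<le> t \<Longrightarrow> t \<le> 0 \<Longrightarrow> \<bar>y t $ q / e $ q\<bar> \<le> B"
      using trajectory_initially_bounded[OF y e] unfolding assms(6) by blast
    show ?thesis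
      using half_line delays B trajectory_bellman[OF process e delay y]
      by (rule bounded_deviation_from_drift)
  qed
  define R :: "real ^ 'q" where "R = (\<chi> q. \<rho> q * e $ q)"
  have throughput: "throughput N = R"
    using assms(7)
  proof (rule throughput_eqI)
    fix y assume "trajectory N y"
    then obtain K where K: "\<And>t q. - real T \<le> t \<Longrightarrow> \<bar>y t $ q / e $ q - \<rho> q * t\<bar> \<le> K"
      using deviation by blast
    have "\<bar>y t $ q - t * R $ q\<bar> \<le> (\<Sum>q\<in>UNIV. \<bar>K\<bar> * e $ q)" if "0 \<le> t" for t q
    proof -
      have "y t $ q - t * R $ q = (y t $ q / e $ q - \<rho> q * t) * e $ q"
        using e by (simp add: R_def left_diff_distrib less_imp_neq[THEN not_sym])
      then have "\<bar>y t $ q - t * R $ q\<bar> = \<bar>y t $ q / e $ q - \<rho> q * t\<bar> * e $ q"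
        using e by (simp add: abs_mult abs_of_pos)
      also have "\<dots> \<le> \<bar>K\<bar> * e $ q"
        using K[of t q] that e by (intro mult_right_mono) (auto simp: less_imp_le)
      also have "\<dots> \<le> (\<Sum>q\<in>UNIV. \<bar>K\<bar> * e $ q)"
        by (rule member_le_sum) (use e in \<open>auto simp: less_imp_le\<close>)
      finally show ?thesis .
    qed
    then show "\<exists>K. \<forall>t\<ge>0. \<forall>q. \<bar>y t $ q - t * R $ q\<bar> \<le> K" by blast
  qed
  define X where "X k q = z (real k) $ q / e $ q" for k :: nat and q
  obtain K where K: "\<And>t q. - real T \<le> t \<Longrightarrow> \<bar>z t $ q / e $ q - \<rho> q * t\<bar> \<le> K"
    using deviation[OF assms(7)] by blast
  have X_bounded: "\<bar>X k q - \<rho> q * real k\<bar> \<le> K" for k q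
    using K[of "real k" q] by (simp add: X_def)
  have X_dynamics: "bellman (action_cost N e) (\<lambda>p. X (k - delay N p)) q (X k q)" if "Suc T \<le> k" for k q
  proof -
    have "real (k - delay N p) = real k - delay N p" for p
      using that delays[of p] by (intro of_nat_diff) simp
    then show ?thesis
      using trajectory_bellman[OF process e delay assms(7), of "real k" q] that by (simp add: X_def[abs_def])
  qed
  have "\<exists>(I :: 'q set set) len. (\<forall>Y\<in>I. 1 \<le> len Y) \<and> (\<Sum>Y\<in>I. len Y) \<le> CARD('q) * T \<and>
    (\<forall>c\<ge>1. (\<forall>Y\<in>I. len Y dvd c) \<longrightarrow>
      (\<forall>k0 q. convergent (\<lambda>j. X (k0 + j * c) q - \<rho> q * real (k0 + j * c))))"
    using half_line delays X_bounded X_dynamics by (rule orbit_minus_drift_periodic)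
  then obtain I :: "'q set set" and len where
      len: "\<forall>Y\<in>I. 1 \<le> len Y" "(\<Sum>Y\<in>I. len Y) \<le> CARD('q) * T"
    and periodic: "\<forall>c\<ge>1. (\<forall>Y\<in>I. len Y dvd c) \<longrightarrow>
      (\<forall>k0 q. convergent (\<lambda>j. X (k0 + j * c) q - \<rho> q * real (k0 + j * c)))"
    by (elim exE conjE)
  obtain \<sigma> where \<sigma>: "\<sigma> \<in> carrier (sym_group (CARD('q) * T))"
    and dvd: "\<forall>Y\<in>I. len Y dvd sym.ord \<sigma>"
    using permutation_with_cycle_lengths[OF finite len(1)[rule_format] len(2)] by blast
  have "finite (carrier (sym_group (CARD('q) * T)))"
    by (simp add: sym_group_def finite_permutations)
  then have ord: "1 \<le> sym.ord \<sigma>" using sym.ord_ge_1 \<sigma> by blast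
  have "convergent (\<lambda>t::nat. z (real (t * sym.ord \<sigma> + r)) - real (t * sym.ord \<sigma> + r) *\<^sub>R throughput N)" for r
  proof -
    let ?k = "\<lambda>t. r + t * sym.ord \<sigma>"
    have "\<forall>q. \<exists>l. (\<lambda>t. X (?k t) q - \<rho> q * real (?k t)) \<longlonglongrightarrow> l"
      using periodic ord dvd by (simp add: convergent_def)
    from choice[OF this] obtain l where l: "\<forall>q. (\<lambda>t. X (?k t) q - \<rho> q * real (?k t)) \<longlonglongrightarrow> l q" ..
    have "(\<lambda>t. z (real (?k t)) - real (?k t) *\<^sub>R throughput N) \<longlonglongrightarrow> (\<chi> q. e $ q * l q)"
    proof (rule vec_tendstoI)
      fix q
      have "(z (real (?k t)) - real (?k t) *\<^sub>R throughput N) $ q =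
          e $ q * (X (?k t) q - \<rho> q * real (?k t))" for t
        using e by (simp add: throughput R_def X_def right_diff_distrib less_imp_neq[THEN not_sym])
      then show "(\<lambda>t. (z (real (?k t)) - real (?k t) *\<^sub>R throughput N) $ q) \<longlonglongrightarrow> (\<chi> q. e $ q * l q) $ q"
        using tendsto_mult_left[OF l[rule_format, of q], of "e $ q"] by simp
    qed
    then show ?thesis by (auto simp: convergent_def add.commute)
  qed
  then show ?thesis using ord \<sigma> by blast
qed

end
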